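(* Let $n\ge 0$ be an integer and let $\psi^n_j(t)=h^n_j(2t-1)\chi_{[0,1)}(t)$ for $0\le j\le n$, where the functions $h^n_j$ on $[-1,1)$ are those defined in the context. Then the set of functions $$\{\,2^{k/2}\psi^n_j(2^k\,\cdot\,-i)\ :\ i,k\in\mathbb{Z},\ j=0,\dots,n\,\}$$ is an orthonormal basis of $L^2(\mathbb{R})$ consisting of compactly supported piecewise polynomial functions.
   Context: Notation: $(a)_0=1$, $(a)_m=a(a+1)\cdots(a+m-1)$ for $m>0$; empty products equal $1$; $\chi_{[0,1)}$ is the indicator function of $[0,1)$ (so $\psi^n_j$ is $0$ outside $[0,1)$). Definition of $h^n_j$: for an integer $n\ge0$, $0\le k\le n$, and $0\le i\le n$ with $i=0$ or $i$ odd, let $$d^i_{n,k}=(-1)^n\frac{\sqrt{2n-2i+1}}{(-n)_i}\frac{(-n)_k(n-i+1)_k}{(1)_k(1)_k}\prod_{m=0}^{\frac{i-1}{2}}(n+k+1-2m)\prod_{m=0}^{\frac{i-3}{2}}(n-k-1-2m).$$ For $0\le t<1$ let $h_{n-i}^n(t)=\sum_{k=0}^n d^i_{n,k}t^k$ if $i=0$ or $i$ is odd, and $h_{n-i}^n(t)=\sum_{k=0}^{n-1} d^{i-1}_{n-1,k}t^k$ if $i>0$ is even ($0\le i\le n$). Extend to $[-1,0)$ by $h^n_i(-t)=(-1)^{i+1}h^n_i(t)$ for $t\in(0,1)$ (and by continuity at $t=-1$). *)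

theory Defs
  imports "HOL-Analysis.Analysis" "HOL-Library.Disjoint_Sets"
    "HOL-Computational_Algebra.Polynomial"
begin

text \<open>
  The coefficient is meant for \<open>i \<le> n\<close>, \<open>k \<le> n\<close> and \<open>i = 0\<close> or \<open>i\<close> odd. The two products run
  over \<open>0 \<le> m \<le> (i - 1)/2\<close> and \<open>0 \<le> m \<le> (i - 3)/2\<close>; both are empty for \<open>i = 0\<close>, and the second
  one is also empty for \<open>i = 1\<close>. Counting factors gives the half-open ranges below.
\<close>

definition d_coeff :: "nat \<Rightarrow> nat \<Rightarrow> nat \<Rightarrow> real" where
  "d_coeff n i k =
     (-1) ^ n * (sqrt (2 * real n - 2 * real i + 1) / pochhammer (- real n) i)
     * (pochhammer (- real n) k * pochhammer (real n - real i + 1) k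
          / (pochhammer 1 k * pochhammer 1 k))
     * (\<Prod>m<(i + 1) div 2. real n + real k + 1 - 2 * real m)
     * (\<Prod>m<(i - 1) div 2. real n - real k - 1 - 2 * real m)"

text \<open>
  The polynomial giving $h^n_j$ on $[0,1)$, for \<open>j \<le> n\<close>. The superscript of the coefficients
  is \<open>i = n - j\<close>; in the last case \<open>i \<ge> 2\<close>, so that no subtraction truncates.
\<close>

definition h_pos :: "nat \<Rightarrow> nat \<Rightarrow> real \<Rightarrow> real" where
  "h_pos n j t =
     (let i = n - j in
      if i = 0 \<or> odd i then \<Sum>k\<le>n. d_coeff n i k * t ^ k
      else \<Sum>k\<le>n - 1. d_coeff (n - 1) (i - 1) k * t ^ k)"

text \<open>
  At \<open>t = -1\<close> the second case is the value obtained by continuity from the right. The value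
  outside $[-1,1)$ is never used.
\<close>

definition h_fun :: "nat \<Rightarrow> nat \<Rightarrow> real \<Rightarrow> real" where
  "h_fun n j t =
     (if 0 \<le> t \<and> t < 1 then h_pos n j t
      else if -1 \<le> t \<and> t < 0 then (-1) ^ (j + 1) * h_pos n j (- t)
      else 0)"

definition psi :: "nat \<Rightarrow> nat \<Rightarrow> real \<Rightarrow> real" where
  "psi n j t = h_fun n j (2 * t - 1) * indicator {0..<1} t"

definition wavelet :: "nat \<Rightarrow> nat \<Rightarrow> int \<Rightarrow> int \<Rightarrow> real \<Rightarrow> real" where
  "wavelet n j k i = (\<lambda>t. 2 powr (real_of_int k / 2) * psi n j (2 powi k * t - real_of_int i))"

definition wavelet_system :: "nat \<Rightarrow> (real \<Rightarrow> real) set" where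
  "wavelet_system n = {wavelet n j k i | i k j. j \<le> n}"

text \<open>
  Elements of complex $L^2(\mathbb{R})$ are represented by square integrable functions. Functions
  that agree almost everywhere are at distance 0, so the density condition below is the one in
  the quotient space.
\<close>

definition L2_functions :: "(real \<Rightarrow> complex) set" where
  "L2_functions =
     {f. f \<in> borel_measurable lebesgue \<and> integrable lebesgue (\<lambda>x. (cmod (f x))\<^sup>2)}"

definition L2_inner :: "(real \<Rightarrow> complex) \<Rightarrow> (real \<Rightarrow> complex) \<Rightarrow> complex" where
  "L2_inner f g = (LINT x|lebesgue. f x * cnj (g x))"

definition L2_norm :: "(real \<Rightarrow> complex) \<Rightarrow> real" where
  "L2_norm f = sqrt (LINT x|lebesgue. (cmod (f x))\<^sup>2)"

definition L2_orthonormal :: "(real \<Rightarrow> complex) set \<Rightarrow> bool" where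
  "L2_orthonormal B \<longleftrightarrow>
     B \<subseteq> L2_functions \<and> (\<forall>f\<in>B. \<forall>g\<in>B. L2_inner f g = (if f = g then 1 else 0))"

text \<open>Orthonormal basis: an orthonormal set whose finite linear combinations are dense.\<close>

definition L2_orthonormal_basis :: "(real \<Rightarrow> complex) set \<Rightarrow> bool" where
  "L2_orthonormal_basis B \<longleftrightarrow>
     L2_orthonormal B \<and>
     (\<forall>f\<in>L2_functions. \<forall>\<epsilon>>0. \<exists>F c. finite F \<and> F \<subseteq> B \<and>
        L2_norm (\<lambda>x. f x - (\<Sum>b\<in>F. c b * b x)) < \<epsilon>)"

definition compactly_supported :: "(real \<Rightarrow> real) \<Rightarrow> bool" where
  "compactly_supported f \<longleftrightarrow> compact (closure {x. f x \<noteq> 0})"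

text \<open>The intervals of the partition may be unbounded, or single points.\<close>

definition piecewise_polynomial :: "(real \<Rightarrow> real) \<Rightarrow> bool" where
  "piecewise_polynomial f \<longleftrightarrow>
     (\<exists>P. finite P \<and> partition_on UNIV P \<and>
        (\<forall>I\<in>P. is_interval I \<and> (\<exists>p :: real poly. \<forall>x\<in>I. f x = poly p x)))"

end

theory Submission
  imports Defs
begin

text \<open>
  Write \<open>h\<^sub>j\<close> for the polynomial that gives $h^n_j$ on $[0,1)$, \<open>e\<^sub>m\<close> for the normalised Legendre
  polynomial of degree \<open>m\<close> on $[0,1)$, and \<open>V\<^sub>k\<close> for the square integrable functions that are
  polynomials of degree at most \<open>n\<close> on every dyadic interval of length $2^{-k}$. The functions
  $\psi^n_j$ span the orthogonal complement of \<open>V\<^sub>0\<close> in \<open>V\<^sub>1\<close> on the unit interval, and the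
  theorem is the resulting decomposition of $L^2$ into the successive differences of the spaces
  \<open>V\<^sub>k\<close>.

  \<^bold>\<open>The polynomials.\<close> Up to a constant, the coefficient of $t^k$ in \<open>h\<^sub>j\<close> is
  $(-1)^k \binom{N}{k} Q(k)$, where \<open>Q\<close> has degree at most \<open>N\<close> and \<open>N\<close> is \<open>n\<close> or \<open>n - 1\<close>. A partial
  fraction identity then turns the moment $\int_0^1 h_j(t) t^m dt$ into a nonzero multiple of
  $Q(-m-1)$. The linear factors in the definition of the coefficients place the zeros of \<open>Q\<close>
  so that \<open>h\<^sub>j\<close> is orthogonal to $t^m$ for $m < j$ and for those $m \le n$ with $m + j$ odd, while \<open>h\<^sub>j\<close>
  itself contains, besides powers up to \<open>j\<close>, only powers $t^k$ with $k + j$ odd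
  (\<open>h_poly_orthogonal_monom\<close>, \<open>coeff_h_poly_eq_0\<close>). So, for indices of equal parity, every
  monomial of \<open>h\<^sub>l\<close> with $l < j$ is orthogonal to \<open>h\<^sub>j\<close>; the squared norm of \<open>h\<^sub>j\<close> is its coefficient at
  $t^j$ times its \<open>j\<close>-th moment, which is 1. For $i = 0$ the polynomials are the \<open>e\<^sub>m\<close>. The parity
  of the extension to $[-1,1)$ makes functions with indices of different parity orthogonal and
  makes $\psi^n_j$ orthogonal to all polynomials of degree at most \<open>n\<close>.

  \<^bold>\<open>Orthonormality.\<close> Two wavelets of the same scale have disjoint supports, or the claim is the one
  for the $\psi^n_j$. A wavelet of a coarser scale is a polynomial of degree at most \<open>n\<close> on the
  support of one of a finer scale, hence orthogonal to it (\<open>wavelet_orthogonal_dyadic_poly\<close>).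

  \<^bold>\<open>Completeness.\<close> The $2(n+1)$ functions \<open>e\<^sub>m\<close> and $\psi^n_j$ on $[0,1)$ are orthonormal and lie in
  the span of the $2(n+1)$ orthonormal functions obtained by copying the \<open>e\<^sub>m\<close> to both halves. A
  square matrix with orthonormal rows has orthonormal columns, so each copied \<open>e\<^sub>m\<close> is
  a combination of the \<open>e\<^sub>l\<close> and $\psi^n_j$ (\<open>two_scale_relation\<close>). Iterating, the indicator of
  a dyadic interval is a finite combination of wavelets plus its projection to the polynomials of
  degree at most \<open>n\<close> on an ancestor interval of length \<open>L\<close>. As the Legendre functions there are
  bounded by a multiple of $L^{-1/2}$, that projection tends to 0 (\<open>scaling_fun_approx\<close>). Thus
  the closed span of the wavelets contains the indicators of dyadic intervals, then by a Dynkin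
  system argument those of bounded measurable sets, and then all of $L^2$ (\<open>L2_in_closed_span\<close>).
\<close>

section \<open>Alternating binomial sums\<close>

text \<open>
  Pascal's rule makes the alternating sum of order \<open>N + 1\<close> the sum of order \<open>N\<close> of the differences
  of \<open>f\<close>. The next two results are inductions along this recursion.
\<close>

lemma alternating_binomial_sum_Suc:
  fixes f :: "nat \<Rightarrow> real"
  shows "(\<Sum>k\<le>Suc N. (-1) ^ k * real (Suc N choose k) * f k)
       = (\<Sum>k\<le>N. (-1) ^ k * real (N choose k) * f k)
       - (\<Sum>k\<le>N. (-1) ^ k * real (N choose k) * f (Suc k))"
proof -
  have "(\<Sum>k\<le>Suc N. (-1) ^ k * real (Suc N choose k) * f k)
      = f 0 + (\<Sum>k\<le>N. (-1) ^ Suc k * real (Suc N choose Suc k) * f (Suc k))"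
    by (subst sum.atMost_Suc_shift) simp
  also have "\<dots> = f 0 + (\<Sum>k\<le>N. (-1) ^ Suc k * real (N choose Suc k) * f (Suc k))
       - (\<Sum>k\<le>N. (-1) ^ k * real (N choose k) * f (Suc k))"
    by (simp add: algebra_simps sum.distrib sum_negf sum_subtractf)
  also have "f 0 + (\<Sum>k\<le>N. (-1) ^ Suc k * real (N choose Suc k) * f (Suc k))
      = (\<Sum>k\<le>Suc N. (-1) ^ k * real (N choose k) * f k)"
    by (subst sum.atMost_Suc_shift) simp
  also have "\<dots> = (\<Sum>k\<le>N. (-1) ^ k * real (N choose k) * f k)"
    by simp
  finally show ?thesis .
qed

text \<open>
  An \<open>N\<close>-th difference annihilates polynomials of degree less than \<open>N\<close>, since one difference
  lowers the degree by one.
\<close>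

lemma alternating_binomial_sum_poly:
  fixes p :: "real poly"
  assumes "degree p < N"
  shows "(\<Sum>k\<le>N. (-1) ^ k * real (N choose k) * poly p (real k)) = 0"
  using assms
proof (induction N arbitrary: p)
  case (Suc N)
  let ?q = "pcompose p [:1, 1:]"
  have eq: "(\<Sum>k\<le>Suc N. (-1) ^ k * real (Suc N choose k) * poly p (real k))
      = (\<Sum>k\<le>N. (-1) ^ k * real (N choose k) * poly (p - ?q) (real k))"
    by (subst alternating_binomial_sum_Suc)
      (simp add: poly_pcompose sum_subtractf[symmetric] algebra_simps)
  show ?case
  proof (cases "degree p = 0")
    case True
    then obtain c where "p = [:c:]" by (rule degree_eq_zeroE)
    then show ?thesis unfolding eq by simp
  next
    case False
    have "coeff ?q (degree p) = coeff p (degree p)"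
      using lead_coeff_comp[of "[:1, 1::real:]" p] by (simp add: degree_pcompose)
    then have "coeff (p - ?q) (degree p) = 0" by simp
    moreover have "degree (p - ?q) \<le> degree p"
      by (intro degree_diff_le) (auto simp: degree_pcompose)
    ultimately have "degree (p - ?q) < degree p \<or> p - ?q = 0"
      by (metis leading_coeff_0_iff le_neq_implies_less)
    then have "degree (p - ?q) < N \<or> p - ?q = 0" using Suc.prems by auto
    then show ?thesis unfolding eq using Suc.IH[of "p - ?q"] by auto
  qed
qed simp

lemma alternating_binomial_sum_inverse:
  fixes x :: real
  assumes "x > 0"
  shows "(\<Sum>k\<le>N. (-1) ^ k * real (N choose k) * (1 / (real k + x)))
       = fact N / pochhammer x (Suc N)"
  using assms
proof (induction N arbitrary: x)
  case (Suc N)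
  have pos: "pochhammer (x + 1) N > 0" using Suc.prems by (simp add: pochhammer_pos)
  have "(\<Sum>k\<le>Suc N. (-1) ^ k * real (Suc N choose k) * (1 / (real k + x)))
      = fact N / pochhammer x (Suc N) - fact N / pochhammer (x + 1) (Suc N)"
    using Suc.IH[of x] Suc.IH[of "x + 1"] Suc.prems
    by (subst alternating_binomial_sum_Suc) (simp add: add_ac)
  also have "pochhammer x (Suc N) = x * pochhammer (x + 1) N"
    by (simp add: pochhammer_rec)
  also have "pochhammer (x + 1) (Suc N) = pochhammer (x + 1) N * (x + 1 + real N)"
    by (simp add: pochhammer_Suc)
  also have "fact N / (x * pochhammer (x + 1) N)
        - fact N / (pochhammer (x + 1) N * (x + 1 + real N))
      = fact (Suc N) / (x * (pochhammer (x + 1) N * (x + 1 + real N)))"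
    using pos Suc.prems by (simp add: divide_simps) (simp add: algebra_simps)
  also have "x * (pochhammer (x + 1) N * (x + 1 + real N)) = pochhammer x (Suc (Suc N))"
    by (subst pochhammer_rec) (simp add: pochhammer_Suc)
  finally show ?case .
qed simp

text \<open>
  Dividing \<open>Q\<close> by the linear factor leaves the remainder \<open>Q (- x)\<close> and a quotient of degree less
  than \<open>N\<close>, which the alternating sum annihilates. With \<open>x = m + 1\<close> this evaluates the \<open>m\<close>-th
  moment of a polynomial whose coefficients are alternating binomial coefficients times the values
  of \<open>Q\<close>.
\<close>

lemma alternating_binomial_sum_poly_over_linear:
  fixes x :: real and Q :: "real poly"
  assumes "x > 0" "degree Q \<le> N"
  shows "(\<Sum>k\<le>N. (-1) ^ k * real (N choose k) * (poly Q (real k) / (real k + x)))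
       = poly Q (-x) * fact N / pochhammer x (Suc N)"
proof -
  let ?c = "poly Q (-x)"
  have "[:- (- x), 1:] dvd (Q - [:?c:])"
    by (subst poly_eq_0_iff_dvd[symmetric]) simp
  then obtain R where R: "Q - [:?c:] = [:x, 1:] * R" by (auto elim: dvdE)
  have degR: "R = 0 \<or> degree R < N"
  proof (cases "R = 0")
    case False
    have "degree (Q - [:?c:]) \<le> N" using assms(2) by (intro degree_diff_le) auto
    moreover have "degree ([:x, 1:] * R) = Suc (degree R)"
      using False by (subst degree_mult_eq) auto
    ultimately show ?thesis using R by simp
  qed simp
  have Qk: "poly Q y = ?c + (y + x) * poly R y" for y
  proof -
    have "poly (Q - [:?c:]) y = poly ([:x, 1:] * R) y" by (simp only: R)
    then show ?thesis by (simp add: algebra_simps)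
  qed
  have "(\<Sum>k\<le>N. (-1) ^ k * real (N choose k) * (poly Q (real k) / (real k + x)))
      = (\<Sum>k\<le>N. ?c * ((-1) ^ k * real (N choose k) * (1 / (real k + x)))
            + (-1) ^ k * real (N choose k) * poly R (real k))"
  proof (rule sum.cong[OF refl])
    fix k
    have "real k + x \<noteq> 0" using assms(1) by (simp add: add_nonneg_eq_0_iff)
    then have "poly Q (real k) / (real k + x) = ?c * (1 / (real k + x)) + poly R (real k)"
      by (subst Qk) (simp add: field_simps)
    then show "(-1) ^ k * real (N choose k) * (poly Q (real k) / (real k + x))
      = ?c * ((-1) ^ k * real (N choose k) * (1 / (real k + x)))
            + (-1) ^ k * real (N choose k) * poly R (real k)"
      by (simp add: algebra_simps)
  qed
  also have "\<dots> = ?c * (fact N / pochhammer x (Suc N))"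
  proof -
    have "(\<Sum>k\<le>N. (-1) ^ k * real (N choose k) * poly R (real k)) = 0"
      using degR alternating_binomial_sum_poly[of R N] by auto
    then show ?thesis
      by (simp only: sum.distrib sum_distrib_left[symmetric]
          alternating_binomial_sum_inverse[OF assms(1)])
  qed
  finally show ?thesis by simp
qed

section \<open>Integrals of polynomials over the unit interval\<close>

definition unit_integral :: "real poly \<Rightarrow> real" where
  "unit_integral p = (LINT x|lborel. indicator {0..<1} x * poly p x)"

lemma borel_measurable_poly [measurable]: "poly (p :: real poly) \<in> borel_measurable borel"
  by (intro borel_measurable_continuous_onI continuous_intros)

lemma has_bochner_integral_unit_poly:
  fixes P :: "real poly"
  assumes "pderiv P = p"
  shows "has_bochner_integral lborel (\<lambda>x. indicator {0..<1} x * poly p x) (poly P 1 - poly P 0)"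
proof -
  have "has_bochner_integral lborel (\<lambda>x. poly p x * indicator {0..1} x) (poly P 1 - poly P 0)"
    unfolding mult.commute[of "poly p _"]
    using has_bochner_integral_FTC_Icc_real[of 0 1 "poly P" "poly p"]
    by (simp add: assms[symmetric] mult.commute)
  then show ?thesis
  proof (rule has_bochner_integralI_AE)
    have "AE x in lborel. x \<noteq> (1::real)" by (rule AE_lborel_singleton)
    then show "AE x in lborel. poly p x * indicator {0..1} x = indicator {0..<1} x * poly p x"
      by eventually_elim (auto simp: indicator_def)
  qed auto
qed

lemma ex_antiderivative_poly: "\<exists>P :: real poly. pderiv P = p"
proof
  show "pderiv (\<Sum>k\<le>degree p. monom (coeff p k / real (Suc k)) (Suc k)) = p"
    by (simp add: higher_pderiv_sum[of 1, simplified] pderiv_monom poly_as_sum_of_monoms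
        del: of_nat_Suc)
qed

lemma unit_integral_FTC: "pderiv P = p \<Longrightarrow> unit_integral p = poly P 1 - poly P 0"
  using has_bochner_integral_unit_poly has_bochner_integral_integral_eq
  unfolding unit_integral_def by blast

lemma unit_integral_monom: "unit_integral (monom c k) = c / real (Suc k)"
  by (subst unit_integral_FTC[of "monom (c / real (Suc k)) (Suc k)"])
    (auto simp: pderiv_monom poly_monom)

lemma unit_integral_add: "unit_integral (p + q) = unit_integral p + unit_integral q"
proof -
  obtain P Q where "pderiv P = p" "pderiv Q = q" using ex_antiderivative_poly by metis
  then show ?thesis
    by (simp add: unit_integral_FTC unit_integral_FTC[of "P + Q"] pderiv_add)
qed

lemma unit_integral_smult: "unit_integral (smult c p) = c * unit_integral p"
  unfolding unit_integral_def by (simp add: mult.left_commute)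

lemma unit_integral_0 [simp]: "unit_integral 0 = 0"
  unfolding unit_integral_def by simp

lemma unit_integral_sum: "unit_integral (\<Sum>i\<in>I. f i) = (\<Sum>i\<in>I. unit_integral (f i))"
  by (induction I rule: infinite_finite_induct) (auto simp: unit_integral_add)

lemma unit_integral_reflect: "unit_integral (pcompose p [:1, -1:]) = unit_integral p"
proof -
  obtain P where P: "pderiv P = p" using ex_antiderivative_poly by metis
  have "pderiv (- pcompose P [:1, -1:]) = pcompose p [:1, -1:]"
    by (simp add: pderiv_minus pderiv_pcompose P pderiv_pCons)
  from unit_integral_FTC[OF this] unit_integral_FTC[OF P] show ?thesis
    by (simp add: poly_pcompose)
qed

lemma unit_integral_halves:
  "unit_integral (pcompose p [:0, 1/2:]) + unit_integral (pcompose p [:1/2, 1/2:])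
     = 2 * unit_integral p"
proof -
  obtain P where P: "pderiv P = p" using ex_antiderivative_poly by metis
  have 1: "pderiv (smult 2 (pcompose P [:0, 1/2:])) = pcompose p [:0, 1/2:]"
    by (simp add: pderiv_smult pderiv_pcompose P pderiv_pCons)
  have 2: "pderiv (smult 2 (pcompose P [:1/2, 1/2:])) = pcompose p [:1/2, 1/2:]"
    by (simp add: pderiv_smult pderiv_pcompose P pderiv_pCons)
  show ?thesis using unit_integral_FTC[OF 1] unit_integral_FTC[OF 2] unit_integral_FTC[OF P]
    by (simp add: poly_pcompose)
qed

section \<open>Moments of the coefficient polynomials\<close>

text \<open>
  The factor of $d^i_{N,k}$ that is left after removing $(-1)^k \binom{N}{k}$ and a factor
  independent of \<open>k\<close>, as a polynomial in \<open>k\<close>. Each of its linear factors is responsible either for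
  a vanishing coefficient (a root \<open>k \<ge> 0\<close>) or for a vanishing moment (a root \<open>- m - 1\<close>).
\<close>

definition node_poly :: "nat \<Rightarrow> nat \<Rightarrow> real poly" where
  "node_poly N i = smult (1 / fact (N - i)) (\<Prod>r<N - i. [:real r + 1, 1:])
     * (\<Prod>m<(i + 1) div 2. [:real N + 1 - 2 * real m, 1:])
     * (\<Prod>m<(i - 1) div 2. [:real N - 1 - 2 * real m, -1:])"

definition alpert_const :: "nat \<Rightarrow> nat \<Rightarrow> real" where
  "alpert_const N i = (-1) ^ N * (sqrt (2 * real N - 2 * real i + 1) / pochhammer (- real N) i)"

lemma poly_node_poly:
  "poly (node_poly N i) z = (\<Prod>r<N - i. z + real r + 1) / fact (N - i)
     * (\<Prod>m<(i + 1) div 2. real N + z + 1 - 2 * real m)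
     * (\<Prod>m<(i - 1) div 2. real N - z - 1 - 2 * real m)"
  unfolding node_poly_def by (simp add: poly_prod algebra_simps)

lemma degree_node_poly:
  assumes "i = 0 \<or> odd i" "i \<le> N"
  shows "degree (node_poly N i) \<le> N"
proof -
  have lin: "degree (\<Prod>m<k. [:f m, c:]) \<le> k" for k and f :: "nat \<Rightarrow> real" and c
    by (rule order_trans[OF degree_prod_sum_le])
      (auto intro!: order_trans[OF sum_bounded_above[where K = 1]] simp: degree_pCons_eq_if)
  have "degree (node_poly N i) \<le> (N - i) + (i + 1) div 2 + (i - 1) div 2"
    unfolding node_poly_def
    by (intro order_trans[OF degree_mult_le] add_mono order_trans[OF degree_smult_le] lin)
  also have "\<dots> \<le> N" using assms by (elim disjE oddE) auto
  finally show ?thesis .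
qed

lemma d_coeff_eq_node_poly:
  assumes "i \<le> N" "k \<le> N"
  shows "d_coeff N i k
       = alpert_const N i * ((-1) ^ k * real (N choose k) * poly (node_poly N i) (real k))"
proof -
  have 1: "pochhammer (- real N) k / pochhammer 1 k = (-1) ^ k * real (N choose k)"
    using gbinomial_pochhammer[of "real N" k]
    by (simp add: binomial_gbinomial pochhammer_fact[symmetric])
  have 2: "pochhammer (real N - real i + 1) k / pochhammer 1 k
      = (\<Prod>r<N - i. real k + real r + 1) / fact (N - i)"
  proof -
    have a: "pochhammer 1 (N - i) * pochhammer (1 + real (N - i)) k = (pochhammer 1 (N - i + k) :: real)"
      by (simp add: pochhammer_product')
    have b: "pochhammer 1 k * pochhammer (1 + real k) (N - i) = (pochhammer 1 (k + (N - i)) :: real)"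
      by (simp add: pochhammer_product')
    have c: "pochhammer (1 + real k) (N - i) = (\<Prod>r<N - i. real k + real r + 1)"
      by (simp add: pochhammer_prod lessThan_atLeast0 algebra_simps)
    have d: "real N - real i + 1 = 1 + real (N - i)" using assms by simp
    have cross: "x / p = y / q" if "q * x = p * y" "p \<noteq> 0" "q \<noteq> 0" for x y p q :: real
      using that by (simp add: frac_eq_eq mult.commute)
    show ?thesis
      unfolding d c[symmetric] pochhammer_fact
    proof (rule cross)
      show "pochhammer 1 (N - i) * pochhammer (1 + real (N - i)) k
          = pochhammer 1 k * pochhammer (1 + real k) (N - i)"
        by (simp only: a b add.commute[of k])
    qed (simp_all add: pochhammer_fact[symmetric])
  qed
  show ?thesis
    unfolding d_coeff_def alpert_const_def poly_node_poly 1[symmetric] 2[symmetric] by simp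
qed

definition alpert_poly :: "nat \<Rightarrow> nat \<Rightarrow> real poly" where
  "alpert_poly N i = (\<Sum>k\<le>N. monom (d_coeff N i k) k)"

lemma coeff_alpert_poly: "coeff (alpert_poly N i) k = (if k \<le> N then d_coeff N i k else 0)"
  unfolding alpert_poly_def by (simp add: coeff_sum)

lemma poly_alpert_poly: "poly (alpert_poly N i) t = (\<Sum>k\<le>N. d_coeff N i k * t ^ k)"
  unfolding alpert_poly_def by (simp add: poly_sum poly_monom)

lemma degree_alpert_poly: "degree (alpert_poly N i) \<le> N"
  by (rule degree_le) (simp add: coeff_alpert_poly)

lemma alpert_poly_moment:
  assumes "i = 0 \<or> odd i" "i \<le> N"
  shows "unit_integral (alpert_poly N i * monom 1 m)
       = alpert_const N i * poly (node_poly N i) (- (real m + 1)) * fact N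
           / pochhammer (real m + 1) (Suc N)"
proof -
  have "unit_integral (alpert_poly N i * monom 1 m)
      = (\<Sum>k\<le>N. d_coeff N i k / real (Suc (k + m)))"
    unfolding alpert_poly_def sum_distrib_right
    by (simp add: unit_integral_sum mult_monom unit_integral_monom)
  also have "\<dots> = (\<Sum>k\<le>N. alpert_const N i *
      ((-1) ^ k * real (N choose k) * (poly (node_poly N i) (real k) / (real k + (real m + 1)))))"
    using assms by (intro sum.cong refl) (simp add: d_coeff_eq_node_poly algebra_simps)
  also have "\<dots> = alpert_const N i * (poly (node_poly N i) (- (real m + 1)) * fact N
      / pochhammer (real m + 1) (Suc N))"
    unfolding sum_distrib_left[symmetric]
    using alternating_binomial_sum_poly_over_linear[OF _ degree_node_poly[OF assms], of "real m + 1"]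
    by (simp only: of_nat_0_le_iff zero_less_one add_nonneg_pos)
  finally show ?thesis by (simp only: times_divide_eq_right mult.assoc)
qed

lemma alpert_poly_orthogonal_monom:
  assumes "i = 0 \<or> odd i" "i \<le> N" "m < N - i \<or> (m \<le> N \<and> odd (m + (N - i)))"
  shows "unit_integral (alpert_poly N i * monom 1 m) = 0"
proof -
  have "poly (node_poly N i) (- (real m + 1)) = 0"
  proof (cases "m < N - i")
    case True
    then show ?thesis unfolding poly_node_poly by auto
  next
    case False
    with assms have m: "m \<le> N" "odd (m + (N - i))" by auto
    with False assms have "odd i" by auto
    define m' where "m' = (N - m) div 2"
    have "even (N - m)" using m \<open>odd i\<close> assms(2) by auto
    then have m': "2 * m' = N - m" unfolding m'_def by simp
    then have "real N + - (real m + 1) + 1 - 2 * real m' = 0" using m(1) by linarith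
    moreover have "m' < (i + 1) div 2" using m' False assms(2) \<open>odd i\<close> by (auto elim!: oddE)
    ultimately have "(\<Prod>m'<(i + 1) div 2. real N + - (real m + 1) + 1 - 2 * real m') = 0"
      by auto
    then show ?thesis unfolding poly_node_poly by simp
  qed
  then show ?thesis using alpert_poly_moment assms by simp
qed

lemma coeff_alpert_poly_eq_0:
  assumes "i = 0 \<or> odd i" "i \<le> N" "k > N - i" "\<not> (k \<le> N \<and> odd (k + (N - i)))"
  shows "coeff (alpert_poly N i) k = 0"
proof (cases "k \<le> N")
  case True
  then have "odd i" using assms by auto
  have "odd (N - k)" using assms True \<open>odd i\<close> by auto
  define m where "m = (N - k - 1) div 2"
  have m: "2 * m = N - k - 1" using \<open>odd (N - k)\<close> unfolding m_def by simp
  have "N - k \<ge> 1" using odd_pos[OF \<open>odd (N - k)\<close>] by linarith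
  then have "real N - real k - 1 - 2 * real m = 0" using m True by linarith
  moreover have "m < (i - 1) div 2"
    using m \<open>odd i\<close> \<open>N - k \<ge> 1\<close> assms(2,3) \<open>odd (N - k)\<close> by (elim oddE) auto
  ultimately have "(\<Prod>m<(i - 1) div 2. real N - real k - 1 - 2 * real m) = 0" by auto
  then have "poly (node_poly N i) (real k) = 0" unfolding poly_node_poly by simp
  then show ?thesis using True assms by (simp add: coeff_alpert_poly d_coeff_eq_node_poly)
qed (simp add: coeff_alpert_poly)

text \<open>
  The even and the odd steps interleave to one rising factorial.
\<close>

lemma prod_descending_steps:
  "(\<Prod>m<Suc q. 2 * a + 2 * real q + 2 - 2 * real m) * (\<Prod>m<q. 2 * a + 2 * real q + 1 - 2 * real m)
     = pochhammer (2 * a + 2) (2 * q + 1)"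
proof (induction q)
  case (Suc q)
  have 1: "(\<Prod>m<Suc (Suc q). 2 * a + 2 * real (Suc q) + 2 - 2 * real m)
      = (2 * a + 2 * real q + 4) * (\<Prod>m<Suc q. 2 * a + 2 * real q + 2 - 2 * real m)"
    by (subst prod.lessThan_Suc_shift) (simp add: algebra_simps)
  have 2: "(\<Prod>m<Suc q. 2 * a + 2 * real (Suc q) + 1 - 2 * real m)
      = (2 * a + 2 * real q + 3) * (\<Prod>m<q. 2 * a + 2 * real q + 1 - 2 * real m)"
    by (subst prod.lessThan_Suc_shift) (simp add: algebra_simps)
  have "pochhammer (2 * a + 2) (2 * Suc q + 1)
      = pochhammer (2 * a + 2) (2 * q + 1) * (2 * a + 2 * real q + 3) * (2 * a + 2 * real q + 4)"
    by (simp add: pochhammer_Suc algebra_simps)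
  then show ?case unfolding 1 2 by (simp only: Suc.IH[symmetric]) (simp only: mult_ac)
qed simp

text \<open>
  The two values of \<open>node_poly\<close> that enter the squared norm: the one at \<open>j\<close> comes from the \<open>j\<close>-th
  coefficient, the one at \<open>- j - 1\<close> from the \<open>j\<close>-th moment. Their products of steps of length two
  are only useful together, where they combine into factorials.
\<close>

lemma node_poly_product:
  assumes "i = 0 \<or> odd i" "i \<le> N" "j = N - i"
  shows "poly (node_poly N i) (real j) * poly (node_poly N i) (- (real j + 1))
       = (-1) ^ j * real (2 * j choose j) * fact i * (fact (2 * j + i + 1) / fact (2 * j + 1))"
proof -
  let ?A = "\<lambda>z::real. (\<Prod>r<N - i. z + real r + 1) / fact (N - i)"
  let ?B = "\<lambda>z::real. (\<Prod>m<(i + 1) div 2. real N + z + 1 - 2 * real m)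
     * (\<Prod>m<(i - 1) div 2. real N - z - 1 - 2 * real m)"
  have A1: "?A (real j) = real (2 * j choose j)"
  proof -
    have "(\<Prod>r<N - i. real j + real r + 1) = pochhammer (1 + real j) j"
      using assms(3) by (simp add: pochhammer_prod lessThan_atLeast0 algebra_simps)
    also have "\<dots> = fact (2 * j) / fact j"
      using pochhammer_product'[of "1::real" j j]
      by (simp add: pochhammer_fact[symmetric] mult_2)
    finally show ?thesis using assms(3) by (simp add: binomial_fact)
  qed
  have A2: "?A (- (real j + 1)) = (-1) ^ j"
  proof -
    have "(\<Prod>r<N - i. - (real j + 1) + real r + 1) = pochhammer (- real j) j"
      using assms(3) by (simp add: pochhammer_prod lessThan_atLeast0 algebra_simps)
    also have "\<dots> = (-1) ^ j * fact j" by (simp add: pochhammer_same)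
    finally show ?thesis using assms(3) by simp
  qed
  have B: "?B (real j) * ?B (- (real j + 1)) = fact i * (fact (2 * j + i + 1) / fact (2 * j + 1))"
  proof (cases "i = 0")
    case False
    with assms obtain q where q: "i = 2 * q + 1" by (auto elim: oddE)
    have N: "real N = real j + 2 * real q + 1" using assms q by linarith
    have d: "(i + 1) div 2 = Suc q" "(i - 1) div 2 = q" using q by auto
    have "?B (real j) * ?B (- (real j + 1))
      = ((\<Prod>m<Suc q. 2 * real j + 2 * real q + 2 - 2 * real m)
          * (\<Prod>m<q. 2 * real j + 2 * real q + 1 - 2 * real m))
        * ((\<Prod>m<Suc q. 2 * (-1/2) + 2 * real q + 2 - 2 * real m)
          * (\<Prod>m<q. 2 * (-1/2) + 2 * real q + 1 - 2 * real m))"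
      unfolding d N by (simp add: algebra_simps del: prod.lessThan_Suc)
    \<comment> \<open>The first two factors are the interleaved product for \<open>a = j\<close>, the last two the one for
      \<open>a = -1/2\<close>.\<close>
    also have "\<dots> = pochhammer (2 * real j + 2) i * pochhammer 1 i"
      unfolding prod_descending_steps q by simp
    also have "pochhammer (2 * real j + 2) i = fact (2 * j + i + 1) / fact (2 * j + 1)"
      using pochhammer_product'[of "1::real" "2 * j + 1" i]
      by (simp add: pochhammer_fact[symmetric] field_simps del: fact_Suc)
    finally show ?thesis by (simp add: pochhammer_fact[symmetric])
  qed simp
  have "poly (node_poly N i) (real j) * poly (node_poly N i) (- (real j + 1))
      = ?A (real j) * ?A (- (real j + 1)) * (?B (real j) * ?B (- (real j + 1)))"
    unfolding poly_node_poly by (simp only: mult_ac)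
  then show ?thesis unfolding A1 A2 B by simp
qed

lemma alpert_poly_coeff_moment:
  assumes "i = 0 \<or> odd i" "i \<le> N" "j = N - i"
  shows "coeff (alpert_poly N i) j * unit_integral (alpert_poly N i * monom 1 j) = 1"
proof -
  have N: "N = i + j" "j \<le> N" using assms by auto
  have c: "(alpert_const N i)\<^sup>2 = (2 * real j + 1) * (fact j / fact N)\<^sup>2"
  proof -
    have "pochhammer (- real N) i = (-1) ^ i * (fact N / fact j)"
    proof -
      have "real (N choose i) = (-1) ^ i * pochhammer (- real N) i / fact i"
        by (simp add: binomial_gbinomial gbinomial_pochhammer)
      moreover have "real (N choose i) = fact N / (fact i * fact j)"
        using assms by (simp add: binomial_fact)
      ultimately have "(-1) ^ i * pochhammer (- real N) i = fact N / fact j"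
        by (simp add: field_simps)
      then have "(-1) ^ i * ((-1) ^ i * pochhammer (- real N) i) = (-1) ^ i * (fact N / fact j)"
        by simp
      then show ?thesis by (simp add: mult.assoc[symmetric] power_mult_distrib[symmetric])
    qed
    moreover have "2 * real N - 2 * real i + 1 = 2 * real j + 1" using N by simp
    ultimately show ?thesis unfolding alpert_const_def
      by (simp add: power_mult_distrib power_divide power_mult[symmetric])
  qed
  have p: "pochhammer (real j + 1) (Suc N) = fact (j + N + 1) / fact j"
  proof -
    have "pochhammer 1 (j + Suc N) = pochhammer 1 j * pochhammer (1 + real j) (Suc N)"
      by (rule pochhammer_product')
    then have "fact (j + N + 1) = fact j * pochhammer (real j + 1) (Suc N)"
      by (simp only: pochhammer_fact[symmetric] Suc_eq_plus1 add.assoc add.commute[of 1 "real j"])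
    then show ?thesis by simp
  qed
  have "coeff (alpert_poly N i) j * unit_integral (alpert_poly N i * monom 1 j)
     = (alpert_const N i)\<^sup>2 * ((-1) ^ j * real (N choose j)) * fact N / pochhammer (real j + 1) (Suc N)
       * (poly (node_poly N i) (real j) * poly (node_poly N i) (- (real j + 1)))"
  proof -
    have "coeff (alpert_poly N i) j
        = alpert_const N i * ((-1) ^ j * real (N choose j) * poly (node_poly N i) (real j))"
      using N(2) d_coeff_eq_node_poly[OF assms(2) N(2)] by (simp only: coeff_alpert_poly if_True)
    moreover have "(x * (y * p)) * (x * q * f / r) = x\<^sup>2 * y * f / r * (p * q)"
      for x y p q f r :: real by (simp add: power2_eq_square)
    ultimately show ?thesis by (simp only: alpert_poly_moment[OF assms(1,2)])
  qed
  also have "\<dots> = (2 * real j + 1) * (fact j / fact N)\<^sup>2 * ((-1) ^ j * (fact N / (fact j * fact i)))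
       * fact N / (fact (2 * j + i + 1) / fact j)
       * ((-1) ^ j * (fact (2 * j) / (fact j * fact j)) * fact i
           * (fact (2 * j + i + 1) / ((2 * real j + 1) * fact (2 * j))))"
  proof -
    have "real (N choose j) = fact N / (fact j * fact i)" using N by (simp add: binomial_fact)
    moreover have "real (2 * j choose j) = fact (2 * j) / (fact j * fact j)"
      by (simp add: binomial_fact)
    moreover have "fact (2 * j + 1) = (2 * real j + 1) * fact (2 * j)" by simp
    moreover have "j + N + 1 = 2 * j + i + 1" using N by simp
    ultimately show ?thesis
      by (simp only: c p node_poly_product[OF assms])
  qed
  also have "\<dots> = ((-1) ^ j * (-1) ^ j)"
  proof -
    have cancel: "a * (b / c)\<^sup>2 * (s * (c / (b * d))) * c / (e / b)
        * (s * (f / (b * b)) * d * (e / (a * f))) = s * s"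
      if "a \<noteq> 0" "b \<noteq> 0" "c \<noteq> 0" "d \<noteq> 0" "e \<noteq> 0" "f \<noteq> 0" for a b c d e f s :: real
      using that by (simp add: power2_eq_square)
    have "2 * real j + 1 \<noteq> 0" by linarith
    then show ?thesis by (intro cancel) auto
  qed
  finally show ?thesis by (simp flip: power_mult_distrib)
qed

lemma unit_integral_minus: "unit_integral (- p) = - unit_integral p"
  using unit_integral_smult[of "-1" p] by simp

lemma smult_sum_right: "smult c (\<Sum>i\<in>I. f i) = (\<Sum>i\<in>I. smult c (f i))"
  by (induction I rule: infinite_finite_induct) (auto simp: smult_add_right)

section \<open>The polynomials on the half interval and their orthogonality\<close>

definition h_poly :: "nat \<Rightarrow> nat \<Rightarrow> real poly" where
  "h_poly n j = (let i = n - j in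
     if i = 0 \<or> odd i then alpert_poly n i else alpert_poly (n - 1) (i - 1))"

lemma poly_h_poly: "poly (h_poly n j) t = h_pos n j t"
  unfolding h_poly_def h_pos_def Let_def by (auto simp: poly_alpert_poly)

text \<open>
  For even \<open>n - j > 0\<close> the polynomial is the one of order \<open>n - 1\<close>. Nothing is lost by the smaller
  order, because then \<open>n + j\<close> is even, so that the exponents \<open>m \<le> n\<close> with \<open>m + j\<close> odd are at most
  \<open>n - 1\<close>. Both cases can therefore be treated alike.
\<close>

lemma h_poly_cases:
  assumes "j \<le> n"
  obtains N i where "h_poly n j = alpert_poly N i" "i = 0 \<or> odd i" "i \<le> N" "j = N - i" "N \<le> n"
    "\<And>m. m \<le> n \<Longrightarrow> odd (m + j) \<Longrightarrow> m \<le> N"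
proof (cases "n - j = 0 \<or> odd (n - j)")
  case True
  then show ?thesis using assms by (intro that[of n "n - j"]) (auto simp: h_poly_def)
next
  case False
  then have ev: "even (n - j)" and pos: "n - j > 0" by auto
  have m: "m \<le> n - 1" if "m \<le> n" "odd (m + j)" for m
  proof -
    have "m \<noteq> n" using that(2) ev assms by auto
    then show ?thesis using that(1) by linarith
  qed
  have "odd (n - j - 1)" using ev pos by simp
  moreover have "j = n - 1 - (n - j - 1)" "n - j - 1 \<le> n - 1" using pos assms by linarith+
  ultimately show ?thesis using False m
    by (intro that[of "n - 1" "n - j - 1"]) (auto simp: h_poly_def)
qed

lemma degree_h_poly: "j \<le> n \<Longrightarrow> degree (h_poly n j) \<le> n"
  by (metis h_poly_cases degree_alpert_poly order_trans)

lemma h_poly_orthogonal_monom: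
  assumes "j \<le> n" "m < j \<or> (m \<le> n \<and> odd (m + j))"
  shows "unit_integral (h_poly n j * monom 1 m) = 0"
proof -
  obtain N i where N: "h_poly n j = alpert_poly N i" "i = 0 \<or> odd i" "i \<le> N" "j = N - i" "N \<le> n"
    "\<And>m. m \<le> n \<Longrightarrow> odd (m + j) \<Longrightarrow> m \<le> N" using h_poly_cases[OF assms(1)] by metis
  show ?thesis unfolding N(1)
    by (rule alpert_poly_orthogonal_monom[OF N(2,3)]) (use assms N(4,6) in auto)
qed

lemma coeff_h_poly_eq_0:
  assumes "j \<le> n" "k > j" "\<not> (k \<le> n \<and> odd (k + j))"
  shows "coeff (h_poly n j) k = 0"
proof -
  obtain N i where N: "h_poly n j = alpert_poly N i" "i = 0 \<or> odd i" "i \<le> N" "j = N - i" "N \<le> n"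
    "\<And>m. m \<le> n \<Longrightarrow> odd (m + j) \<Longrightarrow> m \<le> N" using h_poly_cases[OF assms(1)] by metis
  show ?thesis unfolding N(1)
    by (rule coeff_alpert_poly_eq_0[OF N(2,3)]) (use assms N(4,5) in auto)
qed

lemma h_poly_coeff_moment:
  assumes "j \<le> n"
  shows "coeff (h_poly n j) j * unit_integral (h_poly n j * monom 1 j) = 1"
  by (metis h_poly_cases[OF assms] alpert_poly_coeff_moment)

lemma unit_integral_mult_expand:
  assumes "degree q \<le> n"
  shows "unit_integral (p * q) = (\<Sum>k\<le>n. coeff q k * unit_integral (p * monom 1 k))"
proof -
  have "q = (\<Sum>k\<le>n. smult (coeff q k) (monom 1 k))"
    using poly_as_sum_of_monoms'[OF assms] by (simp add: smult_monom)
  then have "p * q = (\<Sum>k\<le>n. smult (coeff q k) (p * monom 1 k))"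
    by (metis (no_types, lifting) mult_smult_right sum.cong sum_distrib_left)
  then show ?thesis by (simp add: unit_integral_sum unit_integral_smult)
qed

text \<open>
  Every exponent other than \<open>j\<close> drops out: the moments below \<open>j\<close> vanish, and above \<open>j\<close> a nonzero
  coefficient forces \<open>k + j\<close> to be odd, where the moment vanishes.
\<close>

lemma unit_integral_h_poly_self:
  assumes "j \<le> n"
  shows "unit_integral (h_poly n j * h_poly n j) = 1"
proof -
  have "unit_integral (h_poly n j * h_poly n j)
      = (\<Sum>k\<le>n. coeff (h_poly n j) k * unit_integral (h_poly n j * monom 1 k))"
    by (rule unit_integral_mult_expand[OF degree_h_poly[OF assms]])
  also have "\<dots> = (\<Sum>k\<le>n. if k = j then 1 else 0)"
  proof (rule sum.cong[OF refl])
    fix k assume "k \<in> {..n}"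
    then show "coeff (h_poly n j) k * unit_integral (h_poly n j * monom 1 k)
        = (if k = j then 1 else 0)"
      using h_poly_coeff_moment[OF assms] h_poly_orthogonal_monom[OF assms, of k]
        coeff_h_poly_eq_0[OF assms, of k] by (cases k j rule: linorder_cases) auto
  qed
  finally show ?thesis using assms by simp
qed

lemma unit_integral_h_poly_less:
  assumes "j \<le> n" "l < j" "even (j + l)"
  shows "unit_integral (h_poly n j * h_poly n l) = 0"
proof -
  have l: "l \<le> n" using assms by simp
  have "unit_integral (h_poly n j * h_poly n l)
      = (\<Sum>k\<le>n. coeff (h_poly n l) k * unit_integral (h_poly n j * monom 1 k))"
    by (rule unit_integral_mult_expand[OF degree_h_poly[OF l]])
  also have "\<dots> = 0"
  proof (rule sum.neutral, intro ballI)
    fix k assume k: "k \<in> {..n}"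
    show "coeff (h_poly n l) k * unit_integral (h_poly n j * monom 1 k) = 0"
    proof (cases "k < j \<or> odd (k + j)")
      case True
      then show ?thesis using h_poly_orthogonal_monom[OF assms(1), of k] k by auto
    next
      case False
      then show ?thesis using coeff_h_poly_eq_0[OF l, of k] assms by auto
    qed
  qed
  finally show ?thesis .
qed

lemma unit_integral_h_poly_mult:
  assumes "j \<le> n" "l \<le> n" "even (j + l)"
  shows "unit_integral (h_poly n j * h_poly n l) = (if j = l then 1 else 0)"
proof (cases j l rule: linorder_cases)
  case less
  then show ?thesis using unit_integral_h_poly_less[of l n j] assms
    by (simp add: mult.commute add.commute)
qed (use assms unit_integral_h_poly_self unit_integral_h_poly_less in auto)

text \<open>
  A polynomial with the parity of \<open>j + 1\<close> only contains powers whose moments vanish. This is the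
  form in which vanishing moments on $[0,1)$ give vanishing moments of the extension to $[-1,1)$.
\<close>

lemma h_poly_orthogonal_parity:
  assumes "j \<le> n" "degree r \<le> n" "pcompose r [:0, -1:] = smult ((-1) ^ (j + 1)) r"
  shows "unit_integral (h_poly n j * r) = 0"
proof -
  have "coeff r k * unit_integral (h_poly n j * monom 1 k) = 0" if "k \<le> n" for k
  proof (cases "odd (k + j)")
    case True
    then show ?thesis using h_poly_orthogonal_monom[OF assms(1), of k] that by simp
  next
    case False
    have "(-1) ^ k * coeff r k = (-1) ^ (j + 1) * coeff r k"
      using arg_cong[OF assms(3), of "\<lambda>p. coeff p k"] by (simp add: coeff_pcompose_linear)
    then have "coeff r k = 0" using False by (cases "even k"; cases "even j") auto
    then show ?thesis by simp
  qed
  then show ?thesis unfolding unit_integral_mult_expand[OF assms(2)]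
    by (intro sum.neutral) auto
qed

definition legendre :: "nat \<Rightarrow> real poly" where
  "legendre m = h_poly m m"

lemma degree_legendre: "degree (legendre m) \<le> m"
  unfolding legendre_def by (simp add: degree_h_poly)

lemma unit_integral_legendre_less:
  assumes "degree q < m"
  shows "unit_integral (legendre m * q) = 0"
proof -
  have "unit_integral (legendre m * monom 1 k) = 0" if "k \<le> degree q" for k
    unfolding legendre_def by (rule h_poly_orthogonal_monom) (use assms that in auto)
  then show ?thesis unfolding unit_integral_mult_expand[OF order_refl[of "degree q"]]
    by (intro sum.neutral) simp
qed

lemma unit_integral_legendre:
  "unit_integral (legendre l * legendre m) = (if l = m then 1 else 0)"
proof (cases l m rule: linorder_cases)
  case less
  then show ?thesis
    using unit_integral_legendre_less[of "legendre l" m] degree_legendre[of l]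
    by (simp add: mult.commute)
next
  case equal
  then show ?thesis by (simp add: unit_integral_h_poly_self legendre_def)
next
  case greater
  then show ?thesis
    using unit_integral_legendre_less[of "legendre m" l] degree_legendre[of m] by simp
qed

lemma legendre_0: "legendre 0 = 1"
  unfolding legendre_def h_poly_def alpert_poly_def by (simp add: d_coeff_def one_pCons)

lemma legendre_spans: "degree p \<le> n \<Longrightarrow> \<exists>c. p = (\<Sum>m\<le>n. smult (c m) (legendre m))"
proof (induction n arbitrary: p)
  case 0
  then obtain a where "p = [:a:]" by (auto elim: degree_eq_zeroE)
  then show ?case by (intro exI[of _ "\<lambda>_. a"]) (simp add: legendre_0 one_pCons)
next
  case (Suc n)
  define a where "a = coeff p (Suc n) / coeff (legendre (Suc n)) (Suc n)"
  have nz: "coeff (legendre (Suc n)) (Suc n) \<noteq> 0"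
    using h_poly_coeff_moment[of "Suc n" "Suc n"] unfolding legendre_def by auto
  let ?q = "p - smult a (legendre (Suc n))"
  have "degree ?q \<le> n"
  proof (rule degree_le, intro allI impI)
    fix i assume "i > n"
    show "coeff ?q i = 0"
    proof (cases "i = Suc n")
      case True
      then show ?thesis using nz by (simp add: a_def)
    next
      case False
      then have "i > Suc n" using \<open>i > n\<close> by simp
      then show ?thesis using Suc.prems degree_legendre[of "Suc n"]
        by (simp add: coeff_eq_0)
    qed
  qed
  from Suc.IH[OF this] obtain c where c: "?q = (\<Sum>m\<le>n. smult (c m) (legendre m))" by blast
  have "p = ?q + smult a (legendre (Suc n))" by simp
  also have "\<dots> = (\<Sum>m\<le>Suc n. smult ((c(Suc n := a)) m) (legendre m))"
    unfolding c by (simp del: fun_upd_apply) (auto intro!: sum.cong)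
  finally show ?case by blast
qed

lemma legendre_expansion:
  assumes "degree p \<le> n"
  shows "p = (\<Sum>m\<le>n. smult (unit_integral (p * legendre m)) (legendre m))"
proof -
  from legendre_spans[OF assms] obtain c where c: "p = (\<Sum>m\<le>n. smult (c m) (legendre m))" by blast
  have "unit_integral (p * legendre m) = c m" if "m \<le> n" for m
    unfolding c sum_distrib_right using that
    by (simp add: unit_integral_sum unit_integral_smult unit_integral_legendre if_distrib cong: if_cong)
  then show ?thesis using c by simp
qed

lemma legendre_parseval:
  assumes "degree p \<le> n"
  shows "unit_integral (p * q)
       = (\<Sum>m\<le>n. unit_integral (p * legendre m) * unit_integral (q * legendre m))"
  apply (subst legendre_expansion[OF assms])
  unfolding sum_distrib_right
  by (simp add: unit_integral_sum unit_integral_smult mult.commute)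

section \<open>The two-scale relation for polynomials\<close>

text \<open>
  A trace computation: for the Gram matrix \<open>G\<close> of the columns, the squared Frobenius norm of
  \<open>1 - G\<close> is \<open>card J - 2 * card I + card I\<close>, because orthonormal rows give \<open>card I\<close> both for the trace of
  \<open>G\<close> and for its squared norm.
\<close>

lemma orthonormal_rows_imp_orthonormal_columns:
  fixes u :: "'a \<Rightarrow> 'b \<Rightarrow> real"
  assumes fin: "finite I" "finite J" and card: "card I = card J"
    and rows: "\<And>i i'. i \<in> I \<Longrightarrow> i' \<in> I \<Longrightarrow> (\<Sum>j\<in>J. u i j * u i' j) = (if i = i' then 1 else 0)"
    and j: "j \<in> J" "j' \<in> J"
  shows "(\<Sum>i\<in>I. u i j * u i j') = (if j = j' then 1 else 0)"
proof -
  define G where "G j j' = (\<Sum>i\<in>I. u i j * u i j')" for j j'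
  define D where "D j j' = (if j = j' then 1 else 0 :: real)" for j j' :: 'b
  have tr: "(\<Sum>j\<in>J. G j j) = real (card I)"
    unfolding G_def by (subst sum.swap) (simp add: rows)
  have sq: "(\<Sum>j\<in>J. \<Sum>j'\<in>J. (G j j')\<^sup>2) = real (card I)"
  proof -
    have "(\<Sum>j\<in>J. \<Sum>j'\<in>J. (G j j')\<^sup>2)
        = (\<Sum>j\<in>J. \<Sum>j'\<in>J. \<Sum>i\<in>I. \<Sum>i'\<in>I. (u i j * u i' j) * (u i j' * u i' j'))"
      unfolding G_def power2_eq_square sum_product by (simp only: mult_ac)
    also have "\<dots> = (\<Sum>i\<in>I. \<Sum>i'\<in>I. \<Sum>j\<in>J. \<Sum>j'\<in>J. (u i j * u i' j) * (u i j' * u i' j'))"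
    proof -
      have "(\<Sum>j\<in>J. \<Sum>j'\<in>J. \<Sum>i\<in>I. \<Sum>i'\<in>I. f i i' j j')
          = (\<Sum>i\<in>I. \<Sum>i'\<in>I. \<Sum>j\<in>J. \<Sum>j'\<in>J. f i i' j j')" for f :: "'a \<Rightarrow> 'a \<Rightarrow> 'b \<Rightarrow> 'b \<Rightarrow> real"
      proof -
        have "(\<Sum>j\<in>J. \<Sum>j'\<in>J. \<Sum>i\<in>I. \<Sum>i'\<in>I. f i i' j j')
            = (\<Sum>j\<in>J. \<Sum>i\<in>I. \<Sum>j'\<in>J. \<Sum>i'\<in>I. f i i' j j')"
          by (intro sum.cong refl sum.swap)
        also have "\<dots> = (\<Sum>i\<in>I. \<Sum>j\<in>J. \<Sum>j'\<in>J. \<Sum>i'\<in>I. f i i' j j')" by (rule sum.swap)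
        also have "\<dots> = (\<Sum>i\<in>I. \<Sum>j\<in>J. \<Sum>i'\<in>I. \<Sum>j'\<in>J. f i i' j j')"
          by (intro sum.cong refl sum.swap)
        also have "\<dots> = (\<Sum>i\<in>I. \<Sum>i'\<in>I. \<Sum>j\<in>J. \<Sum>j'\<in>J. f i i' j j')"
          by (intro sum.cong refl sum.swap)
        finally show ?thesis .
      qed
      then show ?thesis .
    qed
    also have "\<dots> = (\<Sum>i\<in>I. \<Sum>i'\<in>I. (\<Sum>j\<in>J. u i j * u i' j) * (\<Sum>j'\<in>J. u i j' * u i' j'))"
      by (simp only: sum_product)
    also have "\<dots> = (\<Sum>i\<in>I. \<Sum>i'\<in>I. if i = i' then 1 else 0)"
      by (intro sum.cong refl) (simp add: rows)
    also have "\<dots> = real (card I)" using fin by simp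
    finally show ?thesis .
  qed
  have "(\<Sum>j\<in>J. \<Sum>j'\<in>J. (D j j' - G j j')\<^sup>2)
      = (\<Sum>j\<in>J. \<Sum>j'\<in>J. D j j' - 2 * (if j = j' then G j j' else 0) + (G j j')\<^sup>2)"
    by (intro sum.cong refl) (simp add: D_def power2_eq_square algebra_simps)
  also have "\<dots> = real (card J) - 2 * (\<Sum>j\<in>J. G j j) + (\<Sum>j\<in>J. \<Sum>j'\<in>J. (G j j')\<^sup>2)"
    using fin by (simp add: sum.distrib sum_subtractf D_def sum_distrib_left[symmetric])
  also have "\<dots> = 0" unfolding tr sq using card by simp
  finally have "(\<Sum>j\<in>J. \<Sum>j'\<in>J. (D j j' - G j j')\<^sup>2) = 0" .
  then have "(D j j' - G j j')\<^sup>2 = 0"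
    using fin j by (auto simp: sum_nonneg_eq_0_iff sum_nonneg)
  then show ?thesis by (simp add: G_def D_def)
qed

text \<open>
  Piecewise polynomials on the two halves of $[0,1)$ are represented by a pair of polynomials on
  $[0,1)$: the last argument selects the half (\<open>False\<close> the left one), which is stretched to $[0,1)$,
  and the factor \<open>1 / sqrt 2\<close> keeps norms under this stretching. The index \<open>(m, False)\<close> stands for
  the Legendre polynomial of degree \<open>m\<close>, and \<open>(j, True)\<close> for the function $\psi^n_j$, which on
  the left half is a reflected copy of \<open>h_poly n j\<close>. Indexing both families by one type gives a
  set of the same size as that of the Legendre polynomials on the two halves.
\<close>

definition half_poly :: "nat \<Rightarrow> nat \<times> bool \<Rightarrow> bool \<Rightarrow> real poly" where
  "half_poly n a s = smult (1 / sqrt 2)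
     (case a of
        (m, False) \<Rightarrow> pcompose (legendre m) [:if s then 1/2 else 0, 1/2:]
      | (j, True) \<Rightarrow> if s then h_poly n j else smult ((-1) ^ (j + 1)) (pcompose (h_poly n j) [:1, -1:]))"

lemma degree_pcompose_linear_le: "degree (pcompose p [:a, b:]) \<le> degree p" for p :: "real poly"
  by (rule order_trans[OF degree_pcompose_le]) (simp add: degree_pCons_eq_if)

lemma degree_half_poly: "fst a \<le> n \<Longrightarrow> degree (half_poly n a s) \<le> n"
  unfolding half_poly_def
  by (auto simp: degree_h_poly split: prod.split bool.split
      intro!: order_trans[OF degree_pcompose_linear_le] intro: order_trans[OF degree_legendre])

text \<open>
  After reflecting the left half, both terms are integrals of \<open>h_poly n j\<close> against one polynomial,
  and adding the reflected copy with the sign of \<open>j + 1\<close> gives this polynomial the parity of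
  \<open>j + 1\<close>.
\<close>

lemma h_poly_halves_orthogonal:
  assumes "j \<le> n" "degree r \<le> n"
  shows "(-1) ^ (j + 1) * unit_integral (pcompose (h_poly n j) [:1, -1:] * pcompose r [:0, 1/2:])
       + unit_integral (h_poly n j * pcompose r [:1/2, 1/2:]) = 0"
proof -
  define s where "s = pcompose r [:1/2, 1/2:] + smult ((-1) ^ (j + 1)) (pcompose r [:1/2, -1/2:])"
  have comp: "pcompose (pcompose r [:a, b:]) [:c, d:] = pcompose r [:a + b * c, b * d:]" for a b c d
    by (simp add: pcompose_assoc[symmetric] pcompose_pCons)
  have "unit_integral (pcompose (h_poly n j) [:1, -1:] * pcompose r [:0, 1/2:])
      = unit_integral (pcompose (h_poly n j * pcompose r [:1/2, -1/2:]) [:1, -1:])"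
    by (simp add: pcompose_mult comp)
  then have refl: "unit_integral (pcompose (h_poly n j) [:1, -1:] * pcompose r [:0, 1/2:])
      = unit_integral (h_poly n j * pcompose r [:1/2, -1/2:])"
    by (simp add: unit_integral_reflect)
  have "degree s \<le> n" unfolding s_def
    by (intro degree_add_le order_trans[OF degree_smult_le]
        order_trans[OF degree_pcompose_linear_le] assms(2))
  moreover have "pcompose s [:0, -1:] = smult ((-1) ^ (j + 1)) s"
    unfolding s_def
    by (cases "even j") (simp_all add: pcompose_add pcompose_diff pcompose_uminus comp)
  ultimately have "unit_integral (h_poly n j * s) = 0"
    by (rule h_poly_orthogonal_parity[OF assms(1)])
  then show ?thesis
    unfolding s_def refl distrib_left unit_integral_add mult_smult_right unit_integral_smult
    by (simp only: add.commute)
qed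

lemma half_poly_orthonormal:
  assumes "fst a \<le> n" "fst b \<le> n"
  shows "(\<Sum>s\<in>UNIV. unit_integral (half_poly n a s * half_poly n b s)) = (if a = b then 1 else 0)"
proof -
  have LW: "(\<Sum>s\<in>UNIV. unit_integral (half_poly n (j, True) s * half_poly n (m, False) s)) = 0"
    if "j \<le> n" "m \<le> n" for j m
  proof -
    have "degree (legendre m) \<le> n" using degree_legendre[of m] that(2) by simp
    from h_poly_halves_orthogonal[OF that(1) this] show ?thesis
      unfolding half_poly_def
      by (cases "even j") (simp_all add: UNIV_bool unit_integral_smult unit_integral_minus)
  qed
  obtain m t where a: "a = (m, t)" by (cases a)
  obtain l t' where b: "b = (l, t')" by (cases b)
  consider "t \<noteq> t'" | "\<not> t" "\<not> t'" | "t" "t'" by blast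
  then show ?thesis
  proof cases
    case 1
    then show ?thesis using LW[of m l] LW[of l m] assms a b by (cases t) (auto simp: mult.commute)
  next
    case 2
    have "(\<Sum>s\<in>UNIV. unit_integral (half_poly n a s * half_poly n b s))
        = unit_integral (legendre m * legendre l)"
      using 2 unit_integral_halves[of "legendre m * legendre l"] unfolding half_poly_def a b
      by (simp add: UNIV_bool unit_integral_smult pcompose_mult)
    then show ?thesis using 2 by (simp add: unit_integral_legendre a b)
  next
    case 3
    have "(\<Sum>s\<in>UNIV. unit_integral (half_poly n a s * half_poly n b s))
        = (1 + (-1) ^ (m + l)) / 2 * unit_integral (h_poly n m * h_poly n l)"
      using 3 unit_integral_reflect[of "h_poly n m * h_poly n l"] unfolding half_poly_def a b
      by (simp add: UNIV_bool unit_integral_smult pcompose_mult power_add field_simps)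
    then show ?thesis using 3 assms
      by (cases "even (m + l)") (auto simp: unit_integral_h_poly_mult a b)
  qed
qed

text \<open>
  The matrix \<open>u\<close> expresses the \<open>half_poly\<close> family in Legendre polynomials on the two halves. Its
  rows are orthonormal, hence so are its columns, and so its transpose expresses the Legendre
  polynomials on the halves by the \<open>half_poly\<close> family.
\<close>

lemma two_scale_halves:
  assumes "m \<le> n"
  shows "\<exists>c. \<forall>s'. (\<Sum>a\<in>{..n} \<times> UNIV. smult (c a) (half_poly n a s'))
       = (if s = s' then legendre m else 0)"
proof -
  define I where "I = {..n} \<times> (UNIV :: bool set)"
  define u where "u a b = unit_integral (half_poly n a (snd b) * legendre (fst b))"
    for a b :: "nat \<times> bool"
  have finI: "finite I" unfolding I_def by simp
  have sumI: "(\<Sum>b\<in>I. f b) = (\<Sum>s\<in>UNIV. \<Sum>l\<le>n. f (l, s))" for f :: "nat \<times> bool \<Rightarrow> 'b::comm_monoid_add"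
    unfolding I_def by (subst sum.swap) (simp add: sum.cartesian_product)
  have cols: "(\<Sum>a\<in>I. u a b * u a b') = (if b = b' then 1 else 0)" if "b \<in> I" "b' \<in> I" for b b'
  proof (rule orthonormal_rows_imp_orthonormal_columns[OF finI finI refl _ that])
    fix a a' assume "a \<in> I" "a' \<in> I"
    then have le: "fst a \<le> n" "fst a' \<le> n" by (auto simp: I_def)
    have "(\<Sum>b\<in>I. u a b * u a' b)
        = (\<Sum>s\<in>UNIV. unit_integral (half_poly n a s * half_poly n a' s))"
      unfolding sumI u_def
      by (intro sum.cong refl)
        (simp only: fst_conv snd_conv legendre_parseval[OF degree_half_poly[OF le(1)], symmetric])
    then show "(\<Sum>b\<in>I. u a b * u a' b) = (if a = a' then 1 else 0)"
      by (simp only: half_poly_orthonormal[OF le])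
  qed
  have "(\<Sum>a\<in>I. smult (u a (m, s)) (half_poly n a s')) = (if s = s' then legendre m else 0)" for s'
  proof -
    have "(\<Sum>a\<in>I. smult (u a (m, s)) (half_poly n a s'))
        = (\<Sum>a\<in>I. smult (u a (m, s)) (\<Sum>l\<le>n. smult (u a (l, s')) (legendre l)))"
    proof (intro sum.cong refl arg_cong2[where f = smult])
      fix a assume "a \<in> I"
      then show "half_poly n a s' = (\<Sum>l\<le>n. smult (u a (l, s')) (legendre l))"
        unfolding u_def using legendre_expansion[OF degree_half_poly, of a n] by (auto simp: I_def)
    qed
    also have "\<dots> = (\<Sum>l\<le>n. \<Sum>a\<in>I. smult (u a (m, s) * u a (l, s')) (legendre l))"
      by (subst sum.swap) (simp only: smult_sum_right smult_smult)
    also have "\<dots> = (\<Sum>l\<le>n. smult (\<Sum>a\<in>I. u a (m, s) * u a (l, s')) (legendre l))"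
      by (simp only: smult_sum)
    also have "\<dots> = (\<Sum>l\<le>n. if l = m then (if s = s' then legendre m else 0) else 0)"
      using assms by (intro sum.cong refl) (subst cols, auto simp: I_def)
    also have "\<dots> = (if s = s' then legendre m else 0)" using assms by simp
    finally show ?thesis .
  qed
  then show ?thesis unfolding I_def by (intro exI[of _ "\<lambda>a. u a (m, s)"]) simp
qed

section \<open>Functions on dyadic intervals\<close>

definition cell_fun :: "real poly \<Rightarrow> real \<Rightarrow> real" where
  "cell_fun p x = indicator {0..<1} x * poly p x"

definition dilate :: "int \<Rightarrow> int \<Rightarrow> (real \<Rightarrow> real) \<Rightarrow> real \<Rightarrow> real" where
  "dilate k i f = (\<lambda>x. 2 powr (real_of_int k / 2) * f (2 powi k * x - real_of_int i))"

definition real_inner_prod :: "(real \<Rightarrow> real) \<Rightarrow> (real \<Rightarrow> real) \<Rightarrow> real" where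
  "real_inner_prod f g = (LINT x|lborel. f x * g x)"

text \<open>
  A class of integrable functions that contains the wavelets and is closed under sums, products
  and dilations, so that all integrals below exist.
\<close>

definition bdd_supp :: "(real \<Rightarrow> real) \<Rightarrow> bool" where
  "bdd_supp f \<longleftrightarrow> f \<in> borel_measurable borel \<and> (\<exists>M. \<forall>x. \<bar>f x\<bar> \<le> M) \<and> (\<exists>R. \<forall>x. f x \<noteq> 0 \<longrightarrow> \<bar>x\<bar> \<le> R)"

lemma bdd_suppI:
  assumes "f \<in> borel_measurable borel" "\<And>x. \<bar>f x\<bar> \<le> M" "\<And>x. f x \<noteq> 0 \<Longrightarrow> \<bar>x\<bar> \<le> R"
  shows "bdd_supp f"
  using assms unfolding bdd_supp_def by blast

lemma bdd_suppE:
  assumes "bdd_supp f"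
  obtains M R where "f \<in> borel_measurable borel" "\<And>x. \<bar>f x\<bar> \<le> M" "\<And>x. f x \<noteq> 0 \<Longrightarrow> \<bar>x\<bar> \<le> R"
  using assms unfolding bdd_supp_def by blast

lemma bdd_supp_measurable: "bdd_supp f \<Longrightarrow> f \<in> borel_measurable borel"
  unfolding bdd_supp_def by blast

lemma bdd_supp_0 [simp]: "bdd_supp (\<lambda>x. 0)"
  by (rule bdd_suppI[of _ 0 0]) auto

lemma bdd_supp_add:
  assumes "bdd_supp f" "bdd_supp g"
  shows "bdd_supp (\<lambda>x. f x + g x)"
proof -
  obtain M R where f: "f \<in> borel_measurable borel" "\<And>x. \<bar>f x\<bar> \<le> M" "\<And>x. f x \<noteq> 0 \<Longrightarrow> \<bar>x\<bar> \<le> R"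
    using assms(1) by (rule bdd_suppE) blast
  obtain M' R' where g: "g \<in> borel_measurable borel" "\<And>x. \<bar>g x\<bar> \<le> M'" "\<And>x. g x \<noteq> 0 \<Longrightarrow> \<bar>x\<bar> \<le> R'"
    using assms(2) by (rule bdd_suppE) blast
  show ?thesis
  proof (rule bdd_suppI[of _ "M + M'" "max R R'"])
    show "\<bar>f x + g x\<bar> \<le> M + M'" for x using f(2)[of x] g(2)[of x] by linarith
    show "\<bar>x\<bar> \<le> max R R'" if "f x + g x \<noteq> 0" for x
      using f(3)[of x] g(3)[of x] that by (cases "f x = 0") auto
  qed (use f(1) g(1) in simp)
qed

lemma bdd_supp_mult:
  assumes "bdd_supp f" "bdd_supp g"
  shows "bdd_supp (\<lambda>x. f x * g x)"
proof -
  obtain M R where f: "f \<in> borel_measurable borel" "\<And>x. \<bar>f x\<bar> \<le> M" "\<And>x. f x \<noteq> 0 \<Longrightarrow> \<bar>x\<bar> \<le> R"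
    using assms(1) by (rule bdd_suppE) blast
  obtain M' R' where g: "g \<in> borel_measurable borel" "\<And>x. \<bar>g x\<bar> \<le> M'" "\<And>x. g x \<noteq> 0 \<Longrightarrow> \<bar>x\<bar> \<le> R'"
    using assms(2) by (rule bdd_suppE) blast
  show ?thesis
  proof (rule bdd_suppI[of _ "M * M'" R])
    show "\<bar>f x * g x\<bar> \<le> M * M'" for x
      unfolding abs_mult using f(2)[of x] g(2)[of x] by (intro mult_mono) auto
  qed (use f g(1) in auto)
qed

lemma bdd_supp_cmult: "bdd_supp f \<Longrightarrow> bdd_supp (\<lambda>x. c * f x)"
proof (erule bdd_suppE)
  fix M R assume f: "f \<in> borel_measurable borel" "\<And>x. \<bar>f x\<bar> \<le> M" "\<And>x. f x \<noteq> 0 \<Longrightarrow> \<bar>x\<bar> \<le> R"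
  show ?thesis
    by (rule bdd_suppI[of _ "\<bar>c\<bar> * M" R]) (use f in \<open>auto simp: abs_mult mult_left_mono\<close>)
qed

lemma bdd_supp_sum:
  "(\<And>i. i \<in> I \<Longrightarrow> bdd_supp (f i)) \<Longrightarrow> bdd_supp (\<lambda>x. \<Sum>i\<in>I. f i x)"
  by (induction I rule: infinite_finite_induct) (auto intro: bdd_supp_add)

lemma bdd_supp_integrable: "bdd_supp f \<Longrightarrow> integrable lborel f"
proof (erule bdd_suppE)
  fix M R assume f: "f \<in> borel_measurable borel" "\<And>x. \<bar>f x\<bar> \<le> M" "\<And>x. f x \<noteq> 0 \<Longrightarrow> \<bar>x\<bar> \<le> R"
  show "integrable lborel f"
  proof (rule integrableI_bounded_set[of "{-R..R}" _ _ M])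
    show "AE x in lborel. x \<in> {- R..R} \<longrightarrow> norm (f x) \<le> M" using f(2) by simp
    show "AE x in lborel. x \<notin> {- R..R} \<longrightarrow> f x = 0" using f(3) by (intro AE_I2) fastforce
    show "emeasure lborel {- R..R} < \<infinity>" by (simp add: emeasure_lborel_Icc_eq)
  qed (use f(1) in auto)
qed

lemma bdd_supp_cell_fun: "bdd_supp (cell_fun p)"
proof -
  have "compact (poly p ` {0..1})"
    by (intro compact_continuous_image continuous_intros) auto
  then obtain M where M: "\<And>x. x \<in> {0..1} \<Longrightarrow> norm (poly p x) \<le> M" "M > 0"
    using bounded_pos[of "poly p ` {0..1}"] compact_imp_bounded by blast
  show ?thesis
  proof (rule bdd_suppI[of _ M 1])
    show "cell_fun p \<in> borel_measurable borel" unfolding cell_fun_def[abs_def] by measurable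
    show "\<bar>cell_fun p x\<bar> \<le> M" for x
      using M(1)[of x] M(2) by (auto simp: cell_fun_def indicator_def)
    show "\<bar>x\<bar> \<le> 1" if "cell_fun p x \<noteq> 0" for x
      using that by (auto simp: cell_fun_def indicator_def split: if_splits)
  qed
qed

lemma bdd_supp_dilate:
  assumes "bdd_supp f" shows "bdd_supp (dilate k i f)"
  using assms
proof (rule bdd_suppE)
  fix M R assume f: "f \<in> borel_measurable borel" "\<And>x. \<bar>f x\<bar> \<le> M" "\<And>x. f x \<noteq> 0 \<Longrightarrow> \<bar>x\<bar> \<le> R"
  have c: "(0::real) < 2 powi k" by simp
  show ?thesis
  proof (rule bdd_suppI[of _ "2 powr (real_of_int k / 2) * M" "(R + \<bar>real_of_int i\<bar>) / 2 powi k"])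
    show "dilate k i f \<in> borel_measurable borel"
      unfolding dilate_def using f(1) by measurable
    show "\<bar>dilate k i f x\<bar> \<le> 2 powr (real_of_int k / 2) * M" for x
      unfolding dilate_def using f(2) by (simp add: abs_mult)
    show "\<bar>x\<bar> \<le> (R + \<bar>real_of_int i\<bar>) / 2 powi k" if "dilate k i f x \<noteq> 0" for x
    proof -
      have "\<bar>2 powi k * x - real_of_int i\<bar> \<le> R" using that f(3) unfolding dilate_def by auto
      then have "\<bar>2 powi k * x\<bar> \<le> R + \<bar>real_of_int i\<bar>" by linarith
      then have "2 powi k * \<bar>x\<bar> \<le> R + \<bar>real_of_int i\<bar>" using c by (simp add: abs_mult)
      then show ?thesis using c by (simp add: pos_le_divide_eq mult.commute)
    qed
  qed
qed

lemma real_inner_prod_commute: "real_inner_prod f g = real_inner_prod g f"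
  unfolding real_inner_prod_def by (simp add: mult.commute)

lemma real_inner_prod_0 [simp]: "real_inner_prod f (\<lambda>x. 0) = 0" "real_inner_prod (\<lambda>x. 0) f = 0"
  unfolding real_inner_prod_def by auto

lemma real_inner_prod_add_left:
  assumes "bdd_supp f" "bdd_supp g" "bdd_supp h"
  shows "real_inner_prod (\<lambda>x. f x + g x) h = real_inner_prod f h + real_inner_prod g h"
  unfolding real_inner_prod_def distrib_right
  by (intro Bochner_Integration.integral_add bdd_supp_integrable bdd_supp_mult assms)

lemma real_inner_prod_cmult_left: "real_inner_prod (\<lambda>x. c * f x) h = c * real_inner_prod f h"
  unfolding real_inner_prod_def by (simp add: mult.assoc)

lemma real_inner_prod_sum_left:
  assumes "\<And>i. i \<in> I \<Longrightarrow> bdd_supp (f i)" "bdd_supp h"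
  shows "real_inner_prod (\<lambda>x. \<Sum>i\<in>I. f i x) h = (\<Sum>i\<in>I. real_inner_prod (f i) h)"
  using assms(1)
  by (induction I rule: infinite_finite_induct)
    (auto simp: real_inner_prod_add_left bdd_supp_sum assms(2))

lemma real_inner_prod_sum_right:
  assumes "\<And>i. i \<in> I \<Longrightarrow> bdd_supp (f i)" "bdd_supp h"
  shows "real_inner_prod h (\<lambda>x. \<Sum>i\<in>I. f i x) = (\<Sum>i\<in>I. real_inner_prod h (f i))"
  using real_inner_prod_sum_left[OF assms] by (simp add: real_inner_prod_commute[of h])

lemma powr_half_square: "2 powr (real_of_int k / 2) * 2 powr (real_of_int k / 2) = 2 powi k"
  by (simp add: powr_add[symmetric] powr_real_of_int')

lemma real_inner_prod_dilate:
  "real_inner_prod (dilate k i f) (dilate k i g) = real_inner_prod f g"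
proof -
  have "real_inner_prod (dilate k i f) (dilate k i g)
     = (LINT x|lborel. 2 powi k * (f (- real_of_int i + 2 powi k * x) * g (- real_of_int i + 2 powi k * x)))"
    unfolding real_inner_prod_def dilate_def powr_half_square[symmetric]
    by (intro Bochner_Integration.integral_cong) (auto simp: algebra_simps)
  also have "\<dots> = 2 powi k * (LINT x|lborel. f (- real_of_int i + 2 powi k * x) * g (- real_of_int i + 2 powi k * x))"
    by simp
  also have "\<dots> = real_inner_prod f g"
    unfolding real_inner_prod_def
    using lborel_integral_real_affine[of "2 powi k" "\<lambda>x. f x * g x" "- real_of_int i"] by simp
  finally show ?thesis .
qed

lemma real_inner_prod_cell_fun: "real_inner_prod (cell_fun p) (cell_fun q) = unit_integral (p * q)"
  unfolding real_inner_prod_def unit_integral_def cell_fun_def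
  by (intro Bochner_Integration.integral_cong) (auto simp: indicator_def)

lemma cell_fun_sum_smult: "cell_fun (\<Sum>a\<in>I. smult (c a) (p a)) x = (\<Sum>a\<in>I. c a * cell_fun (p a) x)"
  unfolding cell_fun_def by (simp add: poly_sum sum_distrib_left mult.left_commute)

lemma cell_fun_0 [simp]: "cell_fun 0 = (\<lambda>x. 0)"
  by (simp add: cell_fun_def fun_eq_iff)

lemma dilate_0 [simp]: "dilate k i (\<lambda>x. 0) = (\<lambda>x. 0)"
  by (simp add: dilate_def)

lemma dilate_sum_cmult:
  "dilate k i (\<lambda>x. \<Sum>a\<in>I. c a * f a x) x = (\<Sum>a\<in>I. c a * dilate k i (f a) x)"
  unfolding dilate_def by (simp add: sum_distrib_left mult.left_commute)

lemma dilate_sum: "dilate k i (\<lambda>x. \<Sum>a\<in>I. f a x) x = (\<Sum>a\<in>I. dilate k i (f a) x)"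
  using dilate_sum_cmult[of k i "\<lambda>_. 1" f I x] by simp

lemma dilate_dilate: "dilate k i (dilate 1 s f) = dilate (k + 1) (2 * i + s) f"
proof
  fix x
  have "2 powr (real_of_int k / 2) * 2 powr (1 / 2) = 2 powr (real_of_int (k + 1) / 2)"
    by (simp add: powr_add[symmetric] add_divide_distrib)
  moreover have "2 powi 1 * (2 powi k * x - real_of_int i) - real_of_int s
      = 2 powi (k + 1) * x - real_of_int (2 * i + s)"
    by (simp add: power_int_add algebra_simps)
  ultimately show "dilate k i (dilate 1 s f) x = dilate (k + 1) (2 * i + s) f x"
    unfolding dilate_def of_int_1 by (simp only: mult.assoc[symmetric])
qed

lemma cell_fun_nonzero_floor: "cell_fun p (y - real_of_int i) \<noteq> 0 \<Longrightarrow> \<lfloor>y\<rfloor> = i"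
  by (auto simp: cell_fun_def indicator_def floor_eq_iff split: if_splits)

lemma dilate_cell_fun_disjoint:
  "i \<noteq> i' \<Longrightarrow> dilate k i (cell_fun p) x * dilate k i' (cell_fun q) x = 0"
  unfolding dilate_def
  using cell_fun_nonzero_floor[of p "2 powi k * x" i] cell_fun_nonzero_floor[of q "2 powi k * x" i']
  by auto

text \<open>
  The functions on $[0,1)$ whose halves are described by \<open>half_poly\<close>.
\<close>

definition generator :: "nat \<Rightarrow> nat \<times> bool \<Rightarrow> real \<Rightarrow> real" where
  "generator n a = (case a of (m, False) \<Rightarrow> cell_fun (legendre m) | (j, True) \<Rightarrow> psi n j)"

lemma generator_halves:
  "generator n a x = (\<Sum>s\<in>UNIV. dilate 1 (of_bool s) (cell_fun (half_poly n a s)) x)"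
proof -
  have sq: "sqrt 2 * (1 / sqrt 2 * y) = y" for y :: real by simp
  have dil: "(\<Sum>s\<in>UNIV. dilate 1 (of_bool s) (cell_fun (half_poly n a s)) x)
      = sqrt 2 * (indicator {0..<1/2} x * poly (half_poly n a False) (2 * x)
         + indicator {1/2..<1} x * poly (half_poly n a True) (2 * x - 1))"
    unfolding UNIV_bool dilate_def cell_fun_def by (auto simp: powr_half_sqrt indicator_def)
  obtain m t where a: "a = (m, t)" by (cases a)
  show ?thesis
  proof (cases t)
    case False
    then show ?thesis unfolding dil unfolding a generator_def half_poly_def
      by (auto simp: cell_fun_def indicator_def poly_pcompose algebra_simps)
  next
    case True
    then show ?thesis unfolding dil unfolding a generator_def half_poly_def
      by (auto simp: psi_def h_fun_def indicator_def poly_pcompose poly_h_poly algebra_simps)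
  qed
qed

lemma bdd_supp_generator: "bdd_supp (generator n a)"
  unfolding generator_halves[abs_def]
  by (intro bdd_supp_sum bdd_supp_dilate bdd_supp_cell_fun)

lemma generator_orthonormal:
  assumes "fst a \<le> n" "fst b \<le> n"
  shows "real_inner_prod (generator n a) (generator n b) = (if a = b then 1 else 0)"
proof -
  have bs: "bdd_supp (dilate 1 i (cell_fun p))" for i p
    by (intro bdd_supp_dilate bdd_supp_cell_fun)
  have pair: "real_inner_prod (dilate 1 (of_bool s) (cell_fun (half_poly n a s)))
        (dilate 1 (of_bool s') (cell_fun (half_poly n b s')))
      = (if s' = s then unit_integral (half_poly n a s * half_poly n b s) else 0)" for s s'
  proof (cases "s = s'")
    case True
    then show ?thesis by (simp only: real_inner_prod_dilate real_inner_prod_cell_fun if_True refl)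
  next
    case False
    then have "of_bool s \<noteq> (of_bool s' :: int)" by simp
    then show ?thesis using False
      unfolding real_inner_prod_def by (simp add: dilate_cell_fun_disjoint)
  qed
  have "real_inner_prod (generator n a) (generator n b)
      = (\<Sum>s\<in>UNIV. \<Sum>s'\<in>UNIV. real_inner_prod (dilate 1 (of_bool s) (cell_fun (half_poly n a s)))
          (dilate 1 (of_bool s') (cell_fun (half_poly n b s'))))"
    unfolding generator_halves[abs_def]
    by (simp only: real_inner_prod_sum_left real_inner_prod_sum_right bs bdd_supp_sum)
  also have "\<dots> = (\<Sum>s\<in>UNIV. unit_integral (half_poly n a s * half_poly n b s))"
    unfolding pair by simp
  also have "\<dots> = (if a = b then 1 else 0)" by (rule half_poly_orthonormal[OF assms])
  finally show ?thesis .
qed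

lemma two_scale_relation:
  assumes "m \<le> n"
  shows "\<exists>c. \<forall>x. dilate 1 (of_bool s) (cell_fun (legendre m)) x
       = (\<Sum>a\<in>{..n} \<times> UNIV. c a * generator n a x)"
proof -
  obtain c where c: "\<And>s'. (\<Sum>a\<in>{..n} \<times> UNIV. smult (c a) (half_poly n a s'))
       = (if s = s' then legendre m else 0)"
    using two_scale_halves[OF assms, of s] by blast
  have "(\<Sum>a\<in>{..n} \<times> UNIV. c a * generator n a x)
      = dilate 1 (of_bool s) (cell_fun (legendre m)) x" for x
  proof -
    have "(\<Sum>a\<in>{..n} \<times> UNIV. c a * generator n a x)
        = (\<Sum>s'\<in>UNIV. \<Sum>a\<in>{..n} \<times> UNIV. c a * dilate 1 (of_bool s') (cell_fun (half_poly n a s')) x)"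
      unfolding generator_halves sum_distrib_left by (rule sum.swap)
    also have "\<dots> = (\<Sum>s'\<in>UNIV. dilate 1 (of_bool s') (cell_fun (if s = s' then legendre m else 0)) x)"
      unfolding c[symmetric] cell_fun_sum_smult[abs_def] dilate_sum_cmult ..
    also have "\<dots> = dilate 1 (of_bool s) (cell_fun (legendre m)) x"
      by (cases s) (simp_all add: UNIV_bool)
    finally show ?thesis .
  qed
  then show ?thesis by (intro exI[of _ c]) simp
qed

text \<open>
  Orthogonality to the Legendre polynomials suffices, since they span the polynomials of degree at
  most \<open>n\<close>.
\<close>

lemma psi_orthogonal_cell_fun:
  assumes "j \<le> n" "degree r \<le> n"
  shows "real_inner_prod (psi n j) (cell_fun r) = 0"
proof -
  have "real_inner_prod (psi n j) (cell_fun r)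
      = real_inner_prod (psi n j) (\<lambda>x. \<Sum>m\<le>n. unit_integral (r * legendre m) * cell_fun (legendre m) x)"
    by (subst legendre_expansion[OF assms(2)]) (simp only: cell_fun_sum_smult[abs_def])
  also have "\<dots> = (\<Sum>m\<le>n. unit_integral (r * legendre m) * real_inner_prod (psi n j) (cell_fun (legendre m)))"
    using bdd_supp_generator[of n "(j, True)"]
    by (subst real_inner_prod_sum_right)
      (auto simp: generator_def bdd_supp_cell_fun bdd_supp_cmult
        real_inner_prod_commute[of "psi n j"] real_inner_prod_cmult_left)
  also have "\<dots> = 0"
    using generator_orthonormal[of "(j, True)" n "(m, False)" for m] assms(1)
    by (intro sum.neutral) (auto simp: generator_def)
  finally show ?thesis .
qed

section \<open>Orthonormality and shape of the wavelets\<close>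

lemma psi_nonzero_floor: "psi n j (y - real_of_int i) \<noteq> 0 \<Longrightarrow> \<lfloor>y\<rfloor> = i"
  by (auto simp: psi_def indicator_def floor_eq_iff split: if_splits)

lemma wavelet_eq_dilate: "wavelet n j k i = dilate k i (psi n j)"
  unfolding wavelet_def dilate_def ..

lemma wavelet_nonzero_floor: "wavelet n j k i x \<noteq> 0 \<Longrightarrow> \<lfloor>2 powi k * x\<rfloor> = i"
  unfolding wavelet_def using psi_nonzero_floor[of n j "2 powi k * x" i] by auto

lemma bdd_supp_psi: "bdd_supp (psi n j)"
  using bdd_supp_generator[of n "(j, True)"] by (simp add: generator_def)

lemma bdd_supp_wavelet: "bdd_supp (wavelet n j k i)"
  unfolding wavelet_eq_dilate by (intro bdd_supp_dilate bdd_supp_psi)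

definition dyadic_poly :: "nat \<Rightarrow> int \<Rightarrow> (real \<Rightarrow> real) \<Rightarrow> bool" where
  "dyadic_poly n k f \<longleftrightarrow>
     (\<forall>i. \<exists>p. degree p \<le> n \<and> (\<forall>x. \<lfloor>2 powi k * x\<rfloor> = i \<longrightarrow> f x = poly p x))"

text \<open>
  Dyadic intervals of a finer scale are contained in those of a coarser scale; in terms of indices,
  the containing interval is found by integer division by a power of two.
\<close>

lemma dyadic_poly_finer:
  assumes "dyadic_poly n k f" "k \<le> k'"
  shows "dyadic_poly n k' f"
  unfolding dyadic_poly_def
proof
  fix i
  define d where "d = nat (k' - k)"
  have k': "k' = k + int d" using assms(2) by (simp add: d_def)
  have fl: "\<lfloor>2 powi k * x\<rfloor> = \<lfloor>2 powi k' * x\<rfloor> div 2 ^ d" for x :: real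
  proof -
    have "2 powi k * x = 2 powi k' * x / real_of_int (2 ^ d)"
      unfolding k' by (simp add: power_int_add)
    then show ?thesis using floor_divide_real_eq_div[of "2 ^ d" "2 powi k' * x"] by simp
  qed
  obtain p where "degree p \<le> n" "\<And>x. \<lfloor>2 powi k * x\<rfloor> = i div 2 ^ d \<Longrightarrow> f x = poly p x"
    using assms(1) unfolding dyadic_poly_def by blast
  then show "\<exists>p. degree p \<le> n \<and> (\<forall>x. \<lfloor>2 powi k' * x\<rfloor> = i \<longrightarrow> f x = poly p x)"
    using fl by (intro exI[of _ p]) simp
qed

lemma dyadic_poly_add:
  assumes "dyadic_poly n k f" "dyadic_poly n k g"
  shows "dyadic_poly n k (\<lambda>x. f x + g x)"
  unfolding dyadic_poly_def
proof
  fix i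
  obtain p q where "degree p \<le> n" "\<And>x. \<lfloor>2 powi k * x\<rfloor> = i \<Longrightarrow> f x = poly p x"
    "degree q \<le> n" "\<And>x. \<lfloor>2 powi k * x\<rfloor> = i \<Longrightarrow> g x = poly q x"
    using assms unfolding dyadic_poly_def by meson
  then show "\<exists>p. degree p \<le> n \<and> (\<forall>x. \<lfloor>2 powi k * x\<rfloor> = i \<longrightarrow> f x + g x = poly p x)"
    by (intro exI[of _ "p + q"]) (auto intro: degree_add_le)
qed

lemma dilate_cell_fun_on_cell:
  assumes "\<lfloor>2 powi k * x\<rfloor> = i"
  shows "dilate k i (cell_fun p) x
       = poly (smult (2 powr (real_of_int k / 2)) (pcompose p [:- real_of_int i, 2 powi k:])) x"
proof -
  have "2 powi k * x - real_of_int i \<in> {0..<1}"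
    using assms by (auto simp: floor_eq_iff)
  then show ?thesis by (simp add: dilate_def cell_fun_def poly_pcompose algebra_simps)
qed

lemma dilate_cell_fun_off_cell: "\<lfloor>2 powi k * x\<rfloor> \<noteq> i \<Longrightarrow> dilate k i (cell_fun p) x = 0"
  unfolding dilate_def using cell_fun_nonzero_floor[of p "2 powi k * x" i] by auto

lemma dyadic_poly_dilate_cell_fun:
  assumes "degree p \<le> n"
  shows "dyadic_poly n k (dilate k i (cell_fun p))"
  unfolding dyadic_poly_def
proof
  fix i'
  show "\<exists>q. degree q \<le> n \<and> (\<forall>x. \<lfloor>2 powi k * x\<rfloor> = i' \<longrightarrow> dilate k i (cell_fun p) x = poly q x)"
  proof (cases "i' = i")
    case True
    then show ?thesis using assms
      by (intro exI[of _ "smult (2 powr (real_of_int k / 2)) (pcompose p [:- real_of_int i, 2 powi k:])"])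
        (auto simp: dilate_cell_fun_on_cell simp del: poly_smult
          intro!: order_trans[OF degree_smult_le] order_trans[OF degree_pcompose_linear_le])
  next
    case False
    then show ?thesis by (intro exI[of _ 0]) (auto simp: dilate_cell_fun_off_cell)
  qed
qed

lemma wavelet_halves:
  "wavelet n j k i = (\<lambda>x. dilate (k + 1) (2 * i) (cell_fun (half_poly n (j, True) False)) x
      + dilate (k + 1) (2 * i + 1) (cell_fun (half_poly n (j, True) True)) x)"
proof -
  have "psi n j = (\<lambda>x. \<Sum>s\<in>UNIV. dilate 1 (of_bool s) (cell_fun (half_poly n (j, True) s)) x)"
    using generator_halves[of n "(j, True)"] by (auto simp: generator_def)
  then have "wavelet n j k i x
      = (\<Sum>s\<in>UNIV. dilate k i (dilate 1 (of_bool s) (cell_fun (half_poly n (j, True) s))) x)" for x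
    unfolding wavelet_eq_dilate by (simp only: dilate_sum)
  then show ?thesis unfolding dilate_dilate by (auto simp: UNIV_bool add.commute)
qed

lemma dyadic_poly_wavelet: "j \<le> n \<Longrightarrow> dyadic_poly n (k + 1) (wavelet n j k i)"
  unfolding wavelet_halves
  by (intro dyadic_poly_add dyadic_poly_dilate_cell_fun degree_half_poly) auto

text \<open>
  The wavelet only sees the function on one interval of its own scale, where the function is
  a polynomial of degree at most \<open>n\<close>. Rescaling this interval to $[0,1)$ reduces the claim to the
  vanishing moments of $\psi^n_j$.
\<close>

lemma wavelet_orthogonal_dyadic_poly:
  assumes "j \<le> n" "dyadic_poly n k' f" "k' \<le> k"
  shows "real_inner_prod (wavelet n j k i) f = 0"
proof -
  obtain p where p: "degree p \<le> n" "\<And>x. \<lfloor>2 powi k * x\<rfloor> = i \<Longrightarrow> f x = poly p x"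
    using dyadic_poly_finer[OF assms(2,3)] unfolding dyadic_poly_def by blast
  \<comment> \<open>The rescaled polynomial, normalised so that its dilation agrees with \<open>p\<close> on the interval.\<close>
  define r where "r = smult (2 powr (- (real_of_int k / 2)))
    (pcompose p [:real_of_int i / 2 powi k, 1 / 2 powi k:])"
  have r: "degree r \<le> n" unfolding r_def
    by (intro order_trans[OF degree_smult_le] order_trans[OF degree_pcompose_linear_le] p(1))
  have "wavelet n j k i x * f x = dilate k i (psi n j) x * dilate k i (cell_fun r) x" for x
  proof (cases "\<lfloor>2 powi k * x\<rfloor> = i")
    case True
    have "real_of_int i / 2 powi k + (2 powi k * x - real_of_int i) / 2 powi k = x"
      by (simp add: field_simps)
    moreover have "2 powr (real_of_int k / 2) * 2 powr (- (real_of_int k / 2)) = 1"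
      by (simp add: powr_add[symmetric])
    moreover have "2 powi k * x - real_of_int i \<in> {0..<1}"
      using True by (auto simp: floor_eq_iff)
    ultimately have "dilate k i (cell_fun r) x = poly p x"
      unfolding dilate_def cell_fun_def r_def
      by (simp add: poly_pcompose mult.assoc[symmetric])
    then show ?thesis using p(2)[OF True] by (simp add: wavelet_eq_dilate)
  next
    case False
    then show ?thesis using wavelet_nonzero_floor[of n j k i x] by (auto simp: wavelet_eq_dilate)
  qed
  then have "real_inner_prod (wavelet n j k i) f
      = real_inner_prod (dilate k i (psi n j)) (dilate k i (cell_fun r))"
    unfolding real_inner_prod_def by simp
  also have "\<dots> = 0"
    unfolding real_inner_prod_dilate by (rule psi_orthogonal_cell_fun[OF assms(1) r])
  finally show ?thesis .
qed

text \<open>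
  For different scales, the coarser wavelet is a polynomial on the support of the finer one.
\<close>

lemma wavelet_orthonormal:
  assumes "j \<le> n" "j' \<le> n"
  shows "real_inner_prod (wavelet n j k i) (wavelet n j' k' i')
       = (if (j, k, i) = (j', k', i') then 1 else 0)"
proof (cases k k' rule: linorder_cases)
  case less
  then have "real_inner_prod (wavelet n j' k' i') (wavelet n j k i) = 0"
    by (intro wavelet_orthogonal_dyadic_poly[OF assms(2) dyadic_poly_wavelet[OF assms(1)]]) simp
  then show ?thesis using less by (simp add: real_inner_prod_commute)
next
  case greater
  then have "real_inner_prod (wavelet n j k i) (wavelet n j' k' i') = 0"
    by (intro wavelet_orthogonal_dyadic_poly[OF assms(1) dyadic_poly_wavelet[OF assms(2)]]) simp
  then show ?thesis using greater by simp
next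
  case equal
  show ?thesis
  proof (cases "i = i'")
    case True
    then show ?thesis
      using generator_orthonormal[of "(j, True)" n "(j', True)"] assms
      by (simp add: equal wavelet_eq_dilate real_inner_prod_dilate generator_def)
  next
    case False
    then have zero: "wavelet n j k i x * wavelet n j' k' i' x = 0" for x
      using wavelet_nonzero_floor[of n j k i x] wavelet_nonzero_floor[of n j' k' i' x] equal by auto
    show ?thesis using False unfolding real_inner_prod_def by (simp add: zero)
  qed
qed

lemma wavelet_support:
  assumes "wavelet n j k i x \<noteq> 0"
  shows "x \<in> {real_of_int i / 2 powi k..(real_of_int i + 1) / 2 powi k}"
proof -
  have "real_of_int i \<le> 2 powi k * x" "2 powi k * x \<le> real_of_int i + 1"
    using wavelet_nonzero_floor[OF assms] by linarith+
  then show ?thesis by (auto simp: pos_divide_le_eq pos_le_divide_eq mult.commute)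
qed

lemma compactly_supported_wavelet: "compactly_supported (wavelet n j k i)"
proof -
  have "{x. wavelet n j k i x \<noteq> 0} \<subseteq> {real_of_int i / 2 powi k..(real_of_int i + 1) / 2 powi k}"
    using wavelet_support by blast
  then have "bounded {x. wavelet n j k i x \<noteq> 0}"
    by (rule bounded_subset[rotated]) (rule bounded_closed_interval)
  then show ?thesis unfolding compactly_supported_def by (simp add: compact_closure)
qed

lemma piecewise_polynomial_halves:
  fixes f :: "real \<Rightarrow> real"
  assumes "a < b" "b < c" "\<And>x. x < a \<Longrightarrow> f x = 0" "\<And>x. c \<le> x \<Longrightarrow> f x = 0"
    "\<And>x. a \<le> x \<Longrightarrow> x < b \<Longrightarrow> f x = poly p x" "\<And>x. b \<le> x \<Longrightarrow> x < c \<Longrightarrow> f x = poly q x"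
  shows "piecewise_polynomial f"
proof -
  define P where "P = {{..<a}, {a..<b}, {b..<c}, {c..}}"
  have "partition_on UNIV P"
  proof (rule partition_onI)
    show "\<Union> P = UNIV" unfolding P_def using assms(1,2) by auto
    show "disjnt A B" if "A \<in> P" "B \<in> P" "A \<noteq> B" for A B
      using that assms(1,2) unfolding P_def disjnt_def by auto
    have "a - 1 \<in> {..<a}" by simp
    then show "{} \<notin> P"
      using assms(1,2) unfolding P_def by fastforce
  qed
  moreover have "finite P" unfolding P_def by simp
  moreover have "is_interval I \<and> (\<exists>p. \<forall>x\<in>I. f x = poly p x)" if "I \<in> P" for I
  proof -
    consider "I = {..<a}" | "I = {a..<b}" | "I = {b..<c}" | "I = {c..}"
      using \<open>I \<in> P\<close> unfolding P_def by blast
    then show ?thesis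
    proof cases
      case 1 then show ?thesis using assms(3) by (auto intro!: exI[of _ 0] simp: is_interval_1)
    next
      case 2 then show ?thesis using assms(5) by (auto intro!: exI[of _ p] simp: is_interval_1)
    next
      case 3 then show ?thesis using assms(6) by (auto intro!: exI[of _ q] simp: is_interval_1)
    next
      case 4 then show ?thesis using assms(4) by (auto intro!: exI[of _ 0] simp: is_interval_1)
    qed
  qed
  ultimately show ?thesis unfolding piecewise_polynomial_def by blast
qed

lemma piecewise_polynomial_wavelet:
  assumes "j \<le> n"
  shows "piecewise_polynomial (wavelet n j k i)"
proof -
  have pos: "(0::real) < 2 powi (k + 1)" by simp
  define g where "g m = real_of_int m / 2 powi (k + 1)" for m
  have g: "g m \<le> x \<longleftrightarrow> m \<le> \<lfloor>2 powi (k + 1) * x\<rfloor>" "x < g m \<longleftrightarrow> \<lfloor>2 powi (k + 1) * x\<rfloor> < m" for x m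
    unfolding g_def using pos
    by (simp_all add: le_floor_iff floor_less_iff pos_divide_le_eq pos_less_divide_eq mult.commute)
  obtain p where p: "\<And>x. \<lfloor>2 powi (k + 1) * x\<rfloor> = 2 * i \<Longrightarrow> wavelet n j k i x = poly p x"
    using dyadic_poly_wavelet[OF assms, of k i] unfolding dyadic_poly_def by meson
  obtain q where q: "\<And>x. \<lfloor>2 powi (k + 1) * x\<rfloor> = 2 * i + 1 \<Longrightarrow> wavelet n j k i x = poly q x"
    using dyadic_poly_wavelet[OF assms, of k i] unfolding dyadic_poly_def by meson
  have off: "wavelet n j k i x = 0" if "\<lfloor>2 powi (k + 1) * x\<rfloor> \<noteq> 2 * i" "\<lfloor>2 powi (k + 1) * x\<rfloor> \<noteq> 2 * i + 1" for x
    unfolding wavelet_halves using that by (simp add: dilate_cell_fun_off_cell)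
  show ?thesis
  proof (rule piecewise_polynomial_halves)
    show "g (2 * i) < g (2 * i + 1)" "g (2 * i + 1) < g (2 * i + 2)"
      unfolding g_def using pos by (simp_all add: divide_strict_right_mono)
    show "x < g (2 * i) \<Longrightarrow> wavelet n j k i x = 0" "g (2 * i + 2) \<le> x \<Longrightarrow> wavelet n j k i x = 0" for x
      unfolding g by (intro off; linarith)+
    show "wavelet n j k i x = poly p x" if "g (2 * i) \<le> x" "x < g (2 * i + 1)" for x
      using that unfolding g by (intro p) linarith
    show "wavelet n j k i x = poly q x" if "g (2 * i + 1) \<le> x" "x < g (2 * i + 2)" for x
      using that unfolding g by (intro q) linarith
  qed
qed

section \<open>Approximation of Legendre functions by wavelets\<close>

text \<open>
  Linear combinations are generated one term at a time, so that orthogonality and the passage from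
  real to complex functions extend to them by rule induction.
\<close>

inductive_set lin_span :: "('a \<Rightarrow> 'b::comm_ring_1) set \<Rightarrow> ('a \<Rightarrow> 'b) set" for B where
  zero: "(\<lambda>_. 0) \<in> lin_span B"
| step: "b \<in> B \<Longrightarrow> f \<in> lin_span B \<Longrightarrow> (\<lambda>x. c * b x + f x) \<in> lin_span B"

lemma lin_span_add: "f \<in> lin_span B \<Longrightarrow> g \<in> lin_span B \<Longrightarrow> (\<lambda>x. f x + g x) \<in> lin_span B"
proof (induction rule: lin_span.induct)
  case (step b f c)
  then show ?case using lin_span.step[of b B "\<lambda>x. f x + g x" c] by (simp add: add.assoc)
qed simp

lemma lin_span_cmult: "f \<in> lin_span B \<Longrightarrow> (\<lambda>x. c * f x) \<in> lin_span B"
proof (induction rule: lin_span.induct)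
  case (step b f d)
  then show ?case using lin_span.step[of b B "\<lambda>x. c * f x" "c * d"] by (simp add: algebra_simps)
qed (simp add: lin_span.zero)

lemma lin_span_base: "b \<in> B \<Longrightarrow> b \<in> lin_span B"
  using lin_span.step[OF _ lin_span.zero, of b B 1] by simp

lemma lin_span_sum:
  "(\<And>i. i \<in> I \<Longrightarrow> f i \<in> lin_span B) \<Longrightarrow> (\<lambda>x. \<Sum>i\<in>I. f i x) \<in> lin_span B"
  by (induction I rule: infinite_finite_induct) (auto intro: lin_span.zero lin_span_add)

lemma lin_span_mono: "B \<subseteq> C \<Longrightarrow> f \<in> lin_span B \<Longrightarrow> f \<in> lin_span C"
  by (erule lin_span.induct) (auto intro: lin_span.intros)

lemma lin_span_finite_combination:
  "f \<in> lin_span B \<Longrightarrow> \<exists>F c. finite F \<and> F \<subseteq> B \<and> (\<forall>x. f x = (\<Sum>b\<in>F. c b * b x))"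
proof (induction rule: lin_span.induct)
  case zero
  show ?case by (intro exI[of _ "{}"]) simp
next
  case (step b f d)
  then obtain F c where F: "finite F" "F \<subseteq> B" "\<And>x. f x = (\<Sum>b\<in>F. c b * b x)" by blast
  define c' where "c' b' = (if b' = b then d else 0) + (if b' \<in> F then c b' else 0)" for b'
  have "d * b x + f x = (\<Sum>b'\<in>insert b F. c' b' * b' x)" for x
  proof -
    have "(\<Sum>b'\<in>insert b F. c' b' * b' x)
        = (\<Sum>b'\<in>insert b F. if b' = b then d * b x else 0)
        + (\<Sum>b'\<in>insert b F. if b' \<in> F then c b' * b' x else 0)"
      unfolding c'_def sum.distrib[symmetric] by (intro sum.cong refl) (auto simp: distrib_right)
    also have "(\<Sum>b'\<in>insert b F. if b' = b then d * b x else 0) = d * b x"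
      using F(1) by simp
    also have "(\<Sum>b'\<in>insert b F. if b' \<in> F then c b' * b' x else 0) = (\<Sum>b'\<in>F. c b' * b' x)"
      using F(1) by (intro sum.mono_neutral_cong_right) auto
    finally show ?thesis using F(3) by simp
  qed
  then show ?case using F(1,2) step.hyps(1)
    by (intro exI[of _ "insert b F"] exI[of _ c']) auto
qed

text \<open>
  The Legendre polynomial of degree \<open>m\<close>, normalised on the dyadic interval with scale \<open>k\<close> and
  index \<open>i\<close>.
\<close>

definition scaling_fun :: "nat \<Rightarrow> int \<Rightarrow> int \<Rightarrow> real \<Rightarrow> real" where
  "scaling_fun m k i = dilate k i (cell_fun (legendre m))"

definition wavelets_from :: "nat \<Rightarrow> int \<Rightarrow> (real \<Rightarrow> real) set" where
  "wavelets_from n K = {wavelet n j k i | j k i. j \<le> n \<and> K \<le> k}"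

lemma wavelets_from_antimono: "K' \<le> K \<Longrightarrow> wavelets_from n K \<subseteq> wavelets_from n K'"
  unfolding wavelets_from_def using order_trans by blast

lemma bdd_supp_scaling_fun: "bdd_supp (scaling_fun m k i)"
  unfolding scaling_fun_def by (intro bdd_supp_dilate bdd_supp_cell_fun)

lemma scaling_fun_coarsen_step:
  assumes "m \<le> n"
  shows "\<exists>\<beta> w. w \<in> lin_span (wavelets_from n (k - 1)) \<and>
     (\<forall>x. scaling_fun m k i x = (\<Sum>l\<le>n. \<beta> l * scaling_fun l (k - 1) (i div 2) x) + w x)"
proof -
  obtain c where c: "\<And>x. dilate 1 (of_bool (odd i)) (cell_fun (legendre m)) x
       = (\<Sum>a\<in>{..n} \<times> UNIV. c a * generator n a x)"
    using two_scale_relation[OF assms] by blast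
  have i: "2 * (i div 2) + of_bool (odd i) = i" by (cases "even i") (auto elim!: oddE)
  define w where "w x = (\<Sum>l\<le>n. c (l, True) * wavelet n l (k - 1) (i div 2) x)" for x
  have "scaling_fun m k i x
      = (\<Sum>l\<le>n. c (l, False) * scaling_fun l (k - 1) (i div 2) x) + w x" for x
  proof -
    have "scaling_fun m k i x
        = dilate (k - 1) (i div 2) (dilate 1 (of_bool (odd i)) (cell_fun (legendre m))) x"
      unfolding dilate_dilate i scaling_fun_def by simp
    also have "\<dots> = (\<Sum>a\<in>{..n} \<times> UNIV. c a * dilate (k - 1) (i div 2) (generator n a) x)"
      unfolding c[abs_def] dilate_sum_cmult ..
    also have "\<dots> = (\<Sum>l\<le>n. \<Sum>s\<in>UNIV. c (l, s) * dilate (k - 1) (i div 2) (generator n (l, s)) x)"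
      by (simp add: sum.cartesian_product)
    also have "\<dots> = (\<Sum>l\<le>n. c (l, False) * scaling_fun l (k - 1) (i div 2) x) + w x"
      by (simp add: UNIV_bool sum.distrib w_def generator_def scaling_fun_def wavelet_eq_dilate)
    finally show ?thesis .
  qed
  moreover have "w \<in> lin_span (wavelets_from n (k - 1))"
    unfolding w_def[abs_def] wavelets_from_def
    by (intro lin_span_sum lin_span_cmult lin_span_base) auto
  ultimately show ?thesis by (intro exI[of _ "\<lambda>l. c (l, False)"] exI[of _ w]) simp
qed

text \<open>
  Iterates the two-scale relation; the coefficients \<open>\<beta>\<close> are recovered later as inner products.
\<close>

lemma scaling_fun_coarsen:
  assumes "m \<le> n"
  shows "\<exists>i' \<beta> w. w \<in> lin_span (wavelets_from n (k - int r)) \<and>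
     (\<forall>x. scaling_fun m k i x = (\<Sum>l\<le>n. \<beta> l * scaling_fun l (k - int r) i' x) + w x)"
proof (induction r)
  case 0
  show ?case
    by (intro exI[of _ i] exI[of _ "\<lambda>l. of_bool (l = m)"] exI[of _ "\<lambda>_. 0"])
      (use assms in \<open>simp add: lin_span.zero of_bool_def if_distrib[of "\<lambda>c. c * _"] cong: if_cong\<close>)
next
  case (Suc r)
  then obtain i' \<beta> w where w: "w \<in> lin_span (wavelets_from n (k - int r))"
    "\<And>x. scaling_fun m k i x = (\<Sum>l\<le>n. \<beta> l * scaling_fun l (k - int r) i' x) + w x" by blast
  have "\<forall>l. \<exists>\<gamma> v. l \<le> n \<longrightarrow> v \<in> lin_span (wavelets_from n (k - int r - 1)) \<and>
     (\<forall>x. scaling_fun l (k - int r) i' x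
        = (\<Sum>l'\<le>n. \<gamma> l' * scaling_fun l' (k - int r - 1) (i' div 2) x) + v x)"
    using scaling_fun_coarsen_step by blast
  from choice[OF this] obtain \<gamma> where
    "\<forall>l. \<exists>v. l \<le> n \<longrightarrow> v \<in> lin_span (wavelets_from n (k - int r - 1)) \<and>
     (\<forall>x. scaling_fun l (k - int r) i' x
        = (\<Sum>l'\<le>n. \<gamma> l l' * scaling_fun l' (k - int r - 1) (i' div 2) x) + v x)" ..
  from choice[OF this] obtain v where v: "\<And>l. l \<le> n \<Longrightarrow> v l \<in> lin_span (wavelets_from n (k - int r - 1))"
    "\<And>l x. l \<le> n \<Longrightarrow> scaling_fun l (k - int r) i' x
        = (\<Sum>l'\<le>n. \<gamma> l l' * scaling_fun l' (k - int r - 1) (i' div 2) x) + v l x"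
    by auto
  have k: "k - int r - 1 = k - int (Suc r)" by simp
  have "scaling_fun m k i x
      = (\<Sum>l'\<le>n. (\<Sum>l\<le>n. \<beta> l * \<gamma> l l') * scaling_fun l' (k - int (Suc r)) (i' div 2) x)
        + ((\<Sum>l\<le>n. \<beta> l * v l x) + w x)" for x
  proof -
    have "(\<Sum>l\<le>n. \<beta> l * scaling_fun l (k - int r) i' x)
        = (\<Sum>l\<le>n. (\<Sum>l'\<le>n. \<beta> l * \<gamma> l l' * scaling_fun l' (k - int r - 1) (i' div 2) x) + \<beta> l * v l x)"
      by (intro sum.cong refl) (simp add: v(2) distrib_left sum_distrib_left mult.assoc)
    also have "\<dots> = (\<Sum>l'\<le>n. \<Sum>l\<le>n. \<beta> l * \<gamma> l l' * scaling_fun l' (k - int r - 1) (i' div 2) x)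
        + (\<Sum>l\<le>n. \<beta> l * v l x)"
      by (simp only: sum.distrib) (subst sum.swap, rule refl)
    finally show ?thesis unfolding w(2) k by (simp add: sum_distrib_right)
  qed
  moreover have "(\<lambda>x. (\<Sum>l\<le>n. \<beta> l * v l x) + w x) \<in> lin_span (wavelets_from n (k - int (Suc r)))"
  proof (intro lin_span_add lin_span_sum lin_span_cmult)
    show "v l \<in> lin_span (wavelets_from n (k - int (Suc r)))" if "l \<in> {..n}" for l
      using v(1)[of l] that by (simp add: k)
    show "w \<in> lin_span (wavelets_from n (k - int (Suc r)))"
      by (rule lin_span_mono[OF wavelets_from_antimono w(1)]) simp
  qed
  ultimately show ?case
    by (intro exI[of _ "i' div 2"] exI[of _ "\<lambda>l'. \<Sum>l\<le>n. \<beta> l * \<gamma> l l'"]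
        exI[of _ "\<lambda>x. (\<Sum>l\<le>n. \<beta> l * v l x) + w x"]) simp
qed

lemma lin_span_wavelets_bdd_supp: "w \<in> lin_span (wavelets_from n K) \<Longrightarrow> bdd_supp w"
  by (induction rule: lin_span.induct)
    (auto simp: wavelets_from_def intro!: bdd_supp_add bdd_supp_cmult bdd_supp_wavelet)

text \<open>
  The combination that remains in \<open>scaling_fun_coarsen\<close> is orthogonal to the coarse scaling
  functions, so the coefficients of the latter are inner products with the original function.
\<close>

lemma lin_span_wavelets_orthogonal:
  assumes "w \<in> lin_span (wavelets_from n K)" "dyadic_poly n K f" "bdd_supp f"
  shows "real_inner_prod w f = 0"
  using assms(1)
proof (induction rule: lin_span.induct)
  case (step b w c)
  from step(1) obtain j k i where b: "b = wavelet n j k i" "j \<le> n" "K \<le> k"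
    unfolding wavelets_from_def by blast
  have "real_inner_prod (\<lambda>x. c * b x + w x) f = c * real_inner_prod b f + real_inner_prod w f"
    using lin_span_wavelets_bdd_supp[OF step(2)]
    by (simp add: real_inner_prod_add_left bdd_supp_cmult bdd_supp_wavelet b(1) assms(3)
        real_inner_prod_cmult_left)
  then show ?case using wavelet_orthogonal_dyadic_poly[OF b(2) assms(2) b(3)] step.IH b(1) by simp
qed simp

lemma scaling_fun_orthonormal:
  "real_inner_prod (scaling_fun l k i) (scaling_fun m k i) = (if l = m then 1 else 0)"
  unfolding scaling_fun_def
  by (simp add: real_inner_prod_dilate real_inner_prod_cell_fun unit_integral_legendre)

lemma real_inner_prod_bound:
  assumes "bdd_supp f" "bdd_supp g" "\<And>x. \<bar>g x\<bar> \<le> C"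
  shows "\<bar>real_inner_prod f g\<bar> \<le> C * (LINT x|lborel. \<bar>f x\<bar>)"
proof -
  have "\<bar>real_inner_prod f g\<bar> \<le> (LINT x|lborel. \<bar>f x * g x\<bar>)"
    unfolding real_inner_prod_def by (rule integral_abs_bound)
  also have "\<dots> \<le> (LINT x|lborel. C * \<bar>f x\<bar>)"
  proof (rule integral_mono)
    show "integrable lborel (\<lambda>x. \<bar>f x * g x\<bar>)" "integrable lborel (\<lambda>x. C * \<bar>f x\<bar>)"
      using bdd_supp_integrable[OF bdd_supp_mult[OF assms(1,2)]] bdd_supp_integrable[OF assms(1)]
      by auto
    show "\<bar>f x * g x\<bar> \<le> C * \<bar>f x\<bar>" for x
      unfolding abs_mult using mult_right_mono[OF assms(3)[of x], of "\<bar>f x\<bar>"]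
      by (simp add: mult.commute)
  qed
  finally show ?thesis by simp
qed

text \<open>
  After \<open>r\<close> coarsening steps the part not yet expressed by wavelets is a combination of \<open>n + 1\<close>
  orthonormal functions. Its coefficients are inner products of the fixed function \<open>scaling_fun m k i\<close>
  with functions that are uniformly of size $2^{(k-r)/2}$, so its norm tends to 0 as \<open>r\<close> grows.
\<close>

lemma scaling_fun_approx:
  assumes "m \<le> n" "\<epsilon> > 0"
  shows "\<exists>w\<in>lin_span (wavelet_system n).
     bdd_supp w \<and> (LINT x|lborel. (scaling_fun m k i x - w x)\<^sup>2) < \<epsilon>"
proof -
  let ?f = "scaling_fun m k i"
  have "\<exists>M. \<forall>l x. l \<le> n \<longrightarrow> \<bar>cell_fun (legendre l) x\<bar> \<le> M"
  proof -
    have "\<forall>l. \<exists>M. \<forall>x. \<bar>cell_fun (legendre l) x\<bar> \<le> M"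
      using bdd_supp_cell_fun unfolding bdd_supp_def by blast
    then obtain M where M: "\<And>l x. \<bar>cell_fun (legendre l) x\<bar> \<le> M l" by metis
    have "\<bar>cell_fun (legendre l) x\<bar> \<le> Max (M ` {..n})" if "l \<le> n" for l x
      by (rule order_trans[OF M]) (use that in auto)
    then show ?thesis by blast
  qed
  then obtain M where M: "\<And>l x. l \<le> n \<Longrightarrow> \<bar>cell_fun (legendre l) x\<bar> \<le> M" by blast
  define A where "A = M * (LINT x|lborel. \<bar>?f x\<bar>)"
  \<comment> \<open>After \<open>r\<close> steps the squared norm of the remainder is at most \<open>C / 2 ^ r\<close>.\<close>
  define C where "C = (real n + 1) * A\<^sup>2 * 2 powi k"
  have "C \<ge> 0" unfolding C_def by simp
  have "\<epsilon> / (C + 1) > 0" using assms(2) \<open>C \<ge> 0\<close> by simp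
  then obtain r where r: "(1/2 :: real) ^ r < \<epsilon> / (C + 1)"
    using real_arch_pow_inv[of "\<epsilon> / (C + 1)" "1/2"] by auto
  define K where "K = k - int r"
  obtain i' \<beta> w where w: "w \<in> lin_span (wavelets_from n K)"
    and fw: "\<And>x. ?f x = (\<Sum>l\<le>n. \<beta> l * scaling_fun l K i' x) + w x"
    using scaling_fun_coarsen[OF assms(1), of k r i] unfolding K_def by blast
  let ?g = "\<lambda>x. \<Sum>l\<le>n. \<beta> l * scaling_fun l K i' x"
  have bs: "bdd_supp ?g" "bdd_supp w" "bdd_supp (scaling_fun l K i')" for l
    using w by (auto intro!: bdd_supp_sum bdd_supp_cmult bdd_supp_scaling_fun
        intro: lin_span_wavelets_bdd_supp)
  have gl: "real_inner_prod ?g (scaling_fun l K i') = \<beta> l" if "l \<le> n" for l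
    using that
    by (subst real_inner_prod_sum_left)
      (auto simp: bdd_supp_cmult bdd_supp_scaling_fun real_inner_prod_cmult_left
        scaling_fun_orthonormal if_distrib cong: if_cong)
  have beta: "\<bar>\<beta> l\<bar> \<le> 2 powr (real_of_int K / 2) * A" if l: "l \<le> n" for l
  proof -
    have "dyadic_poly n K (scaling_fun l K i')"
      unfolding scaling_fun_def
      by (intro dyadic_poly_dilate_cell_fun order_trans[OF degree_legendre l])
    then have "real_inner_prod w (scaling_fun l K i') = 0"
      by (rule lin_span_wavelets_orthogonal[OF w _ bs(3)])
    moreover have "real_inner_prod ?f (scaling_fun l K i')
        = real_inner_prod ?g (scaling_fun l K i') + real_inner_prod w (scaling_fun l K i')"
      unfolding fw[abs_def] by (rule real_inner_prod_add_left[OF bs])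
    ultimately have "\<beta> l = real_inner_prod ?f (scaling_fun l K i')" using gl[OF l] by simp
    moreover have "\<bar>scaling_fun l K i' x\<bar> \<le> 2 powr (real_of_int K / 2) * M" for x
      unfolding scaling_fun_def dilate_def using M[OF l] by (simp add: abs_mult)
    then have "\<bar>real_inner_prod ?f (scaling_fun l K i')\<bar>
        \<le> 2 powr (real_of_int K / 2) * M * (LINT x|lborel. \<bar>?f x\<bar>)"
      by (intro real_inner_prod_bound bdd_supp_scaling_fun)
    ultimately show ?thesis by (simp add: A_def mult.assoc)
  qed
  have "(LINT x|lborel. (?f x - w x)\<^sup>2) = real_inner_prod ?g ?g"
    unfolding fw real_inner_prod_def by (simp add: power2_eq_square)
  also have "\<dots> = (\<Sum>l\<le>n. \<beta> l * \<beta> l)"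
    by (subst real_inner_prod_sum_left)
      (auto simp: bdd_supp_cmult bdd_supp_scaling_fun bs real_inner_prod_cmult_left
        real_inner_prod_commute[of _ ?g] gl intro!: sum.cong)
  also have "\<dots> \<le> (\<Sum>l\<le>n. 2 powi K * A\<^sup>2)"
  proof (rule sum_mono)
    fix l assume "l \<in> {..n}"
    then have "\<bar>\<beta> l\<bar> * \<bar>\<beta> l\<bar> \<le> (2 powr (real_of_int K / 2) * A) * (2 powr (real_of_int K / 2) * A)"
      by (intro mult_mono beta order_trans[OF abs_ge_zero beta]) auto
    then show "\<beta> l * \<beta> l \<le> 2 powi K * A\<^sup>2"
      unfolding powr_half_square[symmetric] by (simp add: power2_eq_square mult_ac)
  qed
  also have "\<dots> = C * (1/2) ^ r"
    unfolding C_def K_def by (simp add: power_int_diff field_simps power_one_over)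
  also have "\<dots> \<le> (C + 1) * (1/2) ^ r" by (intro mult_right_mono) auto
  also have "\<dots> < \<epsilon>" using r \<open>C \<ge> 0\<close> by (simp add: pos_less_divide_eq mult.commute)
  finally have "(LINT x|lborel. (?f x - w x)\<^sup>2) < \<epsilon>" .
  moreover have "w \<in> lin_span (wavelet_system n)"
    by (rule lin_span_mono[OF _ w]) (auto simp: wavelets_from_def wavelet_system_def)
  ultimately show ?thesis using bs(2) by blast
qed

section \<open>Closed spans in the space of square integrable functions\<close>

text \<open>
  Working with the squared norm, the inequality \<open>L2_sq_add_le\<close> replaces the triangle inequality;
  the factor 2 does no harm in a density argument.
\<close>

definition L2_sq :: "(real \<Rightarrow> complex) \<Rightarrow> real" where
  "L2_sq f = (LINT x|lebesgue. (cmod (f x))\<^sup>2)"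

lemma L2_functionsD:
  assumes "f \<in> L2_functions"
  shows "f \<in> borel_measurable lebesgue" "integrable lebesgue (\<lambda>x. (cmod (f x))\<^sup>2)"
  using assms unfolding L2_functions_def by auto

lemma L2_functions_dominated:
  assumes "f \<in> borel_measurable lebesgue" "integrable lebesgue w" "\<And>x. (cmod (f x))\<^sup>2 \<le> w x"
  shows "f \<in> L2_functions"
  unfolding L2_functions_def
proof (intro CollectI conjI assms(1))
  show "integrable lebesgue (\<lambda>x. (cmod (f x))\<^sup>2)"
  proof (rule Bochner_Integration.integrable_bound[OF assms(2)])
    show "(\<lambda>x. (cmod (f x))\<^sup>2) \<in> borel_measurable lebesgue" using assms(1) by measurable
    show "AE x in lebesgue. norm ((cmod (f x))\<^sup>2) \<le> norm (w x)"
      by (intro AE_I2) (simp add: order_trans[OF assms(3) abs_ge_self])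
  qed
qed

lemma cmod_add_square_le: "(cmod (a + b))\<^sup>2 \<le> 2 * (cmod a)\<^sup>2 + 2 * (cmod b)\<^sup>2"
proof -
  have "(cmod (a + b))\<^sup>2 \<le> (cmod a + cmod b)\<^sup>2" by (intro power_mono norm_triangle_ineq) auto
  also have "\<dots> \<le> 2 * (cmod a)\<^sup>2 + 2 * (cmod b)\<^sup>2"
    using zero_le_power2[of "cmod a - cmod b"] by (simp add: power2_eq_square algebra_simps)
  finally show ?thesis .
qed

lemma L2_functions_add:
  assumes "f \<in> L2_functions" "g \<in> L2_functions"
  shows "(\<lambda>x. f x + g x) \<in> L2_functions"
  by (rule L2_functions_dominated[of _ "\<lambda>x. 2 * (cmod (f x))\<^sup>2 + 2 * (cmod (g x))\<^sup>2"])
    (use L2_functionsD[OF assms(1)] L2_functionsD[OF assms(2)] in \<open>auto intro: cmod_add_square_le\<close>)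

lemma L2_functions_cmult:
  assumes "f \<in> L2_functions"
  shows "(\<lambda>x. c * f x) \<in> L2_functions"
  by (rule L2_functions_dominated[of _ "\<lambda>x. (cmod c)\<^sup>2 * (cmod (f x))\<^sup>2"])
    (use L2_functionsD[OF assms] in \<open>auto simp: norm_mult power_mult_distrib\<close>)

lemma L2_functions_0: "(\<lambda>x. 0) \<in> L2_functions"
  unfolding L2_functions_def by simp

lemma L2_functions_diff:
  assumes "f \<in> L2_functions" "g \<in> L2_functions"
  shows "(\<lambda>x. f x - g x) \<in> L2_functions"
  using L2_functions_add[OF assms(1) L2_functions_cmult[OF assms(2), of "-1"]] by simp

lemma L2_sq_add_le:
  assumes "f \<in> L2_functions" "g \<in> L2_functions"
  shows "L2_sq (\<lambda>x. f x + g x) \<le> 2 * L2_sq f + 2 * L2_sq g"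
proof -
  have "L2_sq (\<lambda>x. f x + g x) \<le> (LINT x|lebesgue. 2 * (cmod (f x))\<^sup>2 + 2 * (cmod (g x))\<^sup>2)"
    unfolding L2_sq_def
    by (intro integral_mono cmod_add_square_le)
      (use L2_functionsD(2)[OF assms(1)] L2_functionsD(2)[OF assms(2)]
        L2_functionsD(2)[OF L2_functions_add[OF assms]] in auto)
  also have "\<dots> = 2 * L2_sq f + 2 * L2_sq g"
    unfolding L2_sq_def using L2_functionsD(2)[OF assms(1)] L2_functionsD(2)[OF assms(2)] by simp
  finally show ?thesis .
qed

lemma L2_sq_cmult: "L2_sq (\<lambda>x. c * f x) = (cmod c)\<^sup>2 * L2_sq f"
  unfolding L2_sq_def by (simp add: norm_mult power_mult_distrib)

lemma L2_sq_nonneg: "L2_sq f \<ge> 0"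
  unfolding L2_sq_def by simp

definition closed_span :: "(real \<Rightarrow> complex) set \<Rightarrow> (real \<Rightarrow> complex) set" where
  "closed_span B = {f \<in> L2_functions. \<forall>\<epsilon>>0. \<exists>g\<in>lin_span B. L2_sq (\<lambda>x. f x - g x) < \<epsilon>}"

lemma closed_span_L2: "f \<in> closed_span B \<Longrightarrow> f \<in> L2_functions"
  unfolding closed_span_def by simp

lemma closed_spanE:
  assumes "f \<in> closed_span B" "\<epsilon> > 0"
  obtains g where "g \<in> lin_span B" "L2_sq (\<lambda>x. f x - g x) < \<epsilon>"
  using assms unfolding closed_span_def by blast

lemma lin_span_L2:
  assumes "B \<subseteq> L2_functions" "f \<in> lin_span B"
  shows "f \<in> L2_functions"
  using assms(2)
  by (induction rule: lin_span.induct)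
    (use assms(1) in \<open>auto intro!: L2_functions_0 L2_functions_add L2_functions_cmult\<close>)

lemma lin_span_subset_closed_span:
  assumes "B \<subseteq> L2_functions" "f \<in> lin_span B"
  shows "f \<in> closed_span B"
  unfolding closed_span_def using lin_span_L2[OF assms] assms(2)
  by (auto intro!: bexI[of _ f] simp: L2_sq_def)

lemma closed_span_limit:
  assumes B: "B \<subseteq> L2_functions" and f: "f \<in> L2_functions"
    and approx: "\<And>\<epsilon>. \<epsilon> > 0 \<Longrightarrow> \<exists>g\<in>closed_span B. L2_sq (\<lambda>x. f x - g x) < \<epsilon>"
  shows "f \<in> closed_span B"
  unfolding closed_span_def
proof (intro CollectI conjI f allI impI)
  fix \<epsilon> :: real assume "\<epsilon> > 0"
  then obtain g where g: "g \<in> closed_span B" "L2_sq (\<lambda>x. f x - g x) < \<epsilon> / 4"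
    using approx[of "\<epsilon> / 4"] by auto
  obtain h where h: "h \<in> lin_span B" "L2_sq (\<lambda>x. g x - h x) < \<epsilon> / 4"
    using closed_spanE[OF g(1), of "\<epsilon> / 4"] \<open>\<epsilon> > 0\<close> by auto
  have "L2_sq (\<lambda>x. (f x - g x) + (g x - h x)) \<le> 2 * L2_sq (\<lambda>x. f x - g x) + 2 * L2_sq (\<lambda>x. g x - h x)"
    by (intro L2_sq_add_le L2_functions_diff f closed_span_L2[OF g(1)] lin_span_L2[OF B h(1)])
  also have "\<dots> < \<epsilon>" using g(2) h(2) by simp
  finally show "\<exists>g\<in>lin_span B. L2_sq (\<lambda>x. f x - g x) < \<epsilon>" using h(1) by auto
qed

lemma closed_span_add:
  assumes B: "B \<subseteq> L2_functions" and "f \<in> closed_span B" "g \<in> closed_span B"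
  shows "(\<lambda>x. f x + g x) \<in> closed_span B"
  unfolding closed_span_def
proof (intro CollectI conjI allI impI L2_functions_add assms(2,3)[THEN closed_span_L2])
  fix \<epsilon> :: real assume "\<epsilon> > 0"
  obtain f' where f': "f' \<in> lin_span B" "L2_sq (\<lambda>x. f x - f' x) < \<epsilon> / 4"
    using closed_spanE[OF assms(2), of "\<epsilon> / 4"] \<open>\<epsilon> > 0\<close> by auto
  obtain g' where g': "g' \<in> lin_span B" "L2_sq (\<lambda>x. g x - g' x) < \<epsilon> / 4"
    using closed_spanE[OF assms(3), of "\<epsilon> / 4"] \<open>\<epsilon> > 0\<close> by auto
  have "L2_sq (\<lambda>x. (f x - f' x) + (g x - g' x)) \<le> 2 * L2_sq (\<lambda>x. f x - f' x) + 2 * L2_sq (\<lambda>x. g x - g' x)"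
    by (intro L2_sq_add_le L2_functions_diff assms(2,3)[THEN closed_span_L2]
        lin_span_L2[OF B] f'(1) g'(1))
  also have "\<dots> < \<epsilon>" using f'(2) g'(2) by simp
  finally show "\<exists>h\<in>lin_span B. L2_sq (\<lambda>x. f x + g x - h x) < \<epsilon>"
    using lin_span_add[OF f'(1) g'(1)] by (auto intro!: bexI simp: algebra_simps)
qed

lemma closed_span_cmult:
  assumes "f \<in> closed_span B"
  shows "(\<lambda>x. c * f x) \<in> closed_span B"
  unfolding closed_span_def
proof (intro CollectI conjI allI impI L2_functions_cmult closed_span_L2[OF assms])
  fix \<epsilon> :: real assume "\<epsilon> > 0"
  have pos: "(cmod c)\<^sup>2 + 1 > 0" by (simp add: add_nonneg_pos)
  obtain g where g: "g \<in> lin_span B" "L2_sq (\<lambda>x. f x - g x) < \<epsilon> / ((cmod c)\<^sup>2 + 1)"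
    using closed_spanE[OF assms, of "\<epsilon> / ((cmod c)\<^sup>2 + 1)"] \<open>\<epsilon> > 0\<close> pos by auto
  have "L2_sq (\<lambda>x. c * f x - c * g x) = (cmod c)\<^sup>2 * L2_sq (\<lambda>x. f x - g x)"
    using L2_sq_cmult[of c "\<lambda>x. f x - g x"] by (simp add: right_diff_distrib)
  also have "\<dots> \<le> ((cmod c)\<^sup>2 + 1) * L2_sq (\<lambda>x. f x - g x)"
    by (intro mult_right_mono L2_sq_nonneg) auto
  also have "\<dots> < \<epsilon>" using g(2) pos by (simp add: pos_less_divide_eq mult.commute)
  finally show "\<exists>h\<in>lin_span B. L2_sq (\<lambda>x. c * f x - h x) < \<epsilon>"
    using lin_span_cmult[OF g(1)] by auto
qed

lemma closed_span_0: "B \<subseteq> L2_functions \<Longrightarrow> (\<lambda>x. 0) \<in> closed_span B"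
  by (intro lin_span_subset_closed_span lin_span.zero)

lemma closed_span_sum:
  assumes "B \<subseteq> L2_functions" "\<And>i. i \<in> I \<Longrightarrow> f i \<in> closed_span B"
  shows "(\<lambda>x. \<Sum>i\<in>I. f i x) \<in> closed_span B"
  using assms(2)
  by (induction I rule: infinite_finite_induct)
    (auto intro: closed_span_add[OF assms(1)] closed_span_0[OF assms(1)])

lemma closed_span_diff:
  assumes "B \<subseteq> L2_functions" "f \<in> closed_span B" "g \<in> closed_span B"
  shows "(\<lambda>x. f x - g x) \<in> closed_span B"
  using closed_span_add[OF assms(1,2) closed_span_cmult[OF assms(3), of "-1"]] by simp

text \<open>
  Dominated convergence, in the form in which it produces new elements of a closed span from
  pointwise limits.
\<close>

lemma closed_span_dominated:
  assumes B: "B \<subseteq> L2_functions" and f: "\<And>k. f k \<in> closed_span B"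
    and lim: "\<And>x. (\<lambda>k. f k x) \<longlonglongrightarrow> g x"
    and w: "integrable lebesgue (\<lambda>x. (w x)\<^sup>2)" "\<And>k x. cmod (f k x) \<le> w x"
  shows "g \<in> closed_span B"
proof -
  have meas: "f k \<in> borel_measurable lebesgue" for k
    using L2_functionsD(1)[OF closed_span_L2[OF f]] .
  have gm: "g \<in> borel_measurable lebesgue"
    by (rule borel_measurable_LIMSEQ_metric[OF meas lim])
  have gw: "cmod (g x) \<le> w x" for x
    by (rule LIMSEQ_le_const2[OF tendsto_norm[OF lim]]) (use w(2) in auto)
  have g2: "g \<in> L2_functions"
    by (rule L2_functions_dominated[OF gm w(1)]) (intro power_mono gw norm_ge_zero)
  have "(\<lambda>k. L2_sq (\<lambda>x. g x - f k x)) \<longlonglongrightarrow> (LINT x|(lebesgue :: real measure). (0::real))"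
    unfolding L2_sq_def
  proof (rule integral_dominated_convergence[where w = "\<lambda>x. 4 * (w x)\<^sup>2" and f = "\<lambda>x. 0"
        and s = "\<lambda>k x. (cmod (g x - f k x))\<^sup>2" and M = lebesgue])
    show "(\<lambda>x. (cmod (g x - f k x))\<^sup>2) \<in> borel_measurable lebesgue" for k
      using gm meas[of k] by measurable
    show "integrable lebesgue (\<lambda>x. 4 * (w x)\<^sup>2)" using w(1) by simp
    show "AE x in lebesgue. (\<lambda>k. (cmod (g x - f k x))\<^sup>2) \<longlonglongrightarrow> 0"
    proof (rule AE_I2)
      fix x
      have "(\<lambda>k. (cmod (g x - f k x))\<^sup>2) \<longlonglongrightarrow> (cmod (g x - g x))\<^sup>2"
        by (intro tendsto_intros lim)
      then show "(\<lambda>k. (cmod (g x - f k x))\<^sup>2) \<longlonglongrightarrow> 0" by simp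
    qed
    show "AE x in lebesgue. norm ((cmod (g x - f k x))\<^sup>2) \<le> 4 * (w x)\<^sup>2" for k
    proof (rule AE_I2)
      fix x
      have "cmod (g x - f k x) \<le> 2 * w x"
        using norm_triangle_ineq4[of "g x" "f k x"] gw[of x] w(2)[of k x] by linarith
      then have "(cmod (g x - f k x))\<^sup>2 \<le> (2 * w x)\<^sup>2" by (intro power_mono) auto
      then show "norm ((cmod (g x - f k x))\<^sup>2) \<le> 4 * (w x)\<^sup>2" by (simp add: power_mult_distrib)
    qed
  qed simp
  then have to0: "(\<lambda>k. L2_sq (\<lambda>x. g x - f k x)) \<longlonglongrightarrow> 0" by simp
  show ?thesis
  proof (rule closed_span_limit[OF B g2])
    fix \<epsilon> :: real assume "\<epsilon> > 0"
    then have "\<forall>\<^sub>F k in sequentially. L2_sq (\<lambda>x. g x - f k x) < \<epsilon>"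
      using to0 by (rule order_tendstoD(2)[rotated])
    then obtain k where "L2_sq (\<lambda>x. g x - f k x) < \<epsilon>" by (auto simp: eventually_sequentially)
    then show "\<exists>h\<in>closed_span B. L2_sq (\<lambda>x. g x - h x) < \<epsilon>" using f by blast
  qed
qed

lemma closed_span_AE:
  assumes B: "B \<subseteq> L2_functions" and f: "f \<in> closed_span B"
    and g: "g \<in> borel_measurable lebesgue" "AE x in lebesgue. g x = f x"
  shows "g \<in> closed_span B"
proof (rule closed_span_limit[OF B])
  have "integrable lebesgue (\<lambda>x. (cmod (g x))\<^sup>2)"
    using L2_functionsD[OF closed_span_L2[OF f]]
    by (subst integrable_cong_AE[where g = "\<lambda>x. (cmod (f x))\<^sup>2"])
      (use g in \<open>auto elim: eventually_mono\<close>)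
  then show "g \<in> L2_functions" using g(1) unfolding L2_functions_def by simp
  have "L2_sq (\<lambda>x. g x - f x) = (LINT x|(lebesgue :: real measure). (0::real))"
    unfolding L2_sq_def using L2_functionsD(1)[OF closed_span_L2[OF f]] g
    by (intro integral_cong_AE) (auto elim: eventually_mono)
  then show "\<exists>h\<in>closed_span B. L2_sq (\<lambda>x. g x - h x) < \<epsilon>" if "\<epsilon> > 0" for \<epsilon>
    using f that by (intro bexI[of _ f]) auto
qed

section \<open>From dyadic intervals to all square integrable functions\<close>

definition dyadic_cell :: "int \<Rightarrow> int \<Rightarrow> real set" where
  "dyadic_cell k i = {x. \<lfloor>2 powi k * x\<rfloor> = i}"

text \<open>
  Rounding both end points down to multiples of $2^{-k}$ gives a finite union of dyadic
  intervals. Its indicator converges at every point, also at the end points, because the intervals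
  are half-open.
\<close>

lemma closed_span_indicator_interval:
  assumes B: "B \<subseteq> L2_functions"
    and cells: "\<And>k i. indicator (dyadic_cell k i) \<in> closed_span B"
  shows "indicator {a..<b::real} \<in> closed_span B"
proof -
  define f where "f k x = (\<Sum>i\<in>{\<lfloor>2 ^ k * a\<rfloor>..<\<lfloor>2 ^ k * b\<rfloor>}. indicator (dyadic_cell (int k) i) x :: complex)"
    for k x
  have f: "f k x = of_bool (\<lfloor>2 ^ k * a\<rfloor> \<le> \<lfloor>2 ^ k * x\<rfloor> \<and> \<lfloor>2 ^ k * x\<rfloor> < \<lfloor>2 ^ k * b\<rfloor>)" for k x
  proof -
    have "f k x = (\<Sum>i\<in>{\<lfloor>2 ^ k * a\<rfloor>..<\<lfloor>2 ^ k * b\<rfloor>}. if i = \<lfloor>2 ^ k * x\<rfloor> then 1 else 0)"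
      unfolding f_def dyadic_cell_def by (intro sum.cong) (auto simp: indicator_def)
    then show ?thesis by simp
  qed
  show ?thesis
  \<comment> \<open>Rounding down moves the left end point by less than \<open>1\<close>.\<close>
  proof (rule closed_span_dominated[OF B, of f _ "indicator {a - 1..b}"])
    show "f k \<in> closed_span B" for k
      unfolding f_def[abs_def] by (intro closed_span_sum[OF B] cells)
    show "integrable lebesgue (\<lambda>x. (indicator {a - 1..b} x :: real)\<^sup>2)"
    proof -
      have "(\<lambda>x. (indicator {a - 1..b} x :: real)\<^sup>2) = indicator {a - 1..b}"
        by (auto simp: indicator_def)
      then show ?thesis by (simp add: integrable_completion integrable_indicator_iff emeasure_lborel_Icc_eq)
    qed
    show "cmod (f k x) \<le> indicator {a - 1..b} x" for k x
    proof (cases "\<lfloor>2 ^ k * a\<rfloor> \<le> \<lfloor>2 ^ k * x\<rfloor> \<and> \<lfloor>2 ^ k * x\<rfloor> < \<lfloor>2 ^ k * b\<rfloor>")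
      case True
      have "2 ^ k * a < 2 ^ k * x + 1" "2 ^ k * x < 2 ^ k * b" using True by linarith+
      moreover have "(1::real) \<le> 2 ^ k" by simp
      ultimately have "2 ^ k * a < 2 ^ k * (x + 1)" "2 ^ k * x < 2 ^ k * b"
        unfolding distrib_left by linarith+
      then have "a < x + 1" "x < b" by simp_all
      then show ?thesis using True by (simp add: f)
    qed (auto simp: f indicator_def)
    show "(\<lambda>k. f k x) \<longlonglongrightarrow> indicator {a..<b} x" for x
    proof -
      have sep: "\<forall>\<^sub>F k in sequentially. \<lfloor>2 ^ k * y\<rfloor> < \<lfloor>2 ^ k * z\<rfloor>" if "y < z" for y z :: real
      proof -
        obtain k0 where k0: "1 / (z - y) < 2 ^ k0"
          using real_arch_pow[of 2 "1 / (z - y)"] by auto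
        have "\<lfloor>2 ^ k * y\<rfloor> < \<lfloor>2 ^ k * z\<rfloor>" if "k \<ge> k0" for k
        proof -
          have "(2::real) ^ k0 \<le> 2 ^ k" using that by simp
          then have "1 / (z - y) < 2 ^ k" using k0 by linarith
          then have "2 ^ k * y + 1 < 2 ^ k * z" using \<open>y < z\<close> by (simp add: pos_divide_less_eq algebra_simps)
          then show ?thesis by linarith
        qed
        then show ?thesis by (auto simp: eventually_sequentially)
      qed
      have mono: "\<lfloor>2 ^ k * y\<rfloor> \<le> \<lfloor>2 ^ k * z\<rfloor>" if "y \<le> z" for y z :: real and k
        using that by (intro floor_mono mult_left_mono) auto
      consider "x < a" | "b \<le> x" | "a \<le> x" "x < b" by linarith
      then have "\<forall>\<^sub>F k in sequentially. f k x = indicator {a..<b} x"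
      proof cases
        case 1
        show ?thesis using sep[OF 1] by eventually_elim (use 1 in \<open>auto simp: f\<close>)
      next
        case 2
        then show ?thesis using mono[OF 2] by (intro always_eventually) (auto simp: f not_less)
      next
        case 3
        show ?thesis using sep[OF 3(2)] by eventually_elim (use 3 mono[OF 3(1)] in \<open>auto simp: f\<close>)
      qed
      then show ?thesis by (rule tendsto_eventually)
    qed
  qed
qed

lemma integrable_indicator_window:
  "integrable lebesgue (\<lambda>x. (indicator {a..<b::real} x :: real)\<^sup>2)"
proof -
  have "(\<lambda>x. (indicator {a..<b} x :: real)\<^sup>2) = indicator {a..<b}"
    by (auto simp: indicator_def)
  moreover have "emeasure lborel {a..<b} < \<infinity>" by (cases "a \<le> b") auto
  ultimately show ?thesis by (simp add: integrable_completion integrable_indicator_iff)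
qed

text \<open>
  The sets that satisfy the claim form a Dynkin system, and half-open intervals are a generator
  stable under intersection. The fixed window \<open>{a..<b}\<close> keeps all indicators square integrable,
  in particular those of complements and countable unions.
\<close>

lemma closed_span_indicator_borel:
  fixes a b :: real
  assumes B: "B \<subseteq> L2_functions"
    and int: "\<And>a b. indicator {a..<b::real} \<in> closed_span B"
    and A: "A \<in> sets borel"
  shows "indicator (A \<inter> {a..<b}) \<in> closed_span B"
proof -
  let ?G = "range (\<lambda>(x, y). {x..<y::real})"
  have A': "A \<in> sigma_sets UNIV ?G"
    using A unfolding borel_eq_atLeastLessThan by simp
  have "Int_stable ?G"
  proof (rule Int_stableI)
    fix X Y assume "X \<in> ?G" "Y \<in> ?G"
    then obtain x y x' y' where "X = {x..<y}" "Y = {x'..<y'}" by auto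
    then have "X \<inter> Y = (\<lambda>(x, y). {x..<y}) (max x x', min y y')" by auto
    then show "X \<inter> Y \<in> ?G" by blast
  qed
  from this subset_UNIV[of ?G, folded Pow_UNIV] A' show ?thesis
  proof (induction rule: sigma_sets_induct_disjoint)
    case (basic X)
    then obtain x y where "X = {x..<y}" by auto
    then have "X \<inter> {a..<b} = {max x a..<min y b}" by auto
    then show ?case using int by simp
  next
    case empty
    then show ?case using closed_span_0[OF B] by (simp add: indicator_def)
  next
    case (compl X)
    have "(indicator ((UNIV - X) \<inter> {a..<b}) :: real \<Rightarrow> complex)
        = (\<lambda>x. indicator {a..<b} x - indicator (X \<inter> {a..<b}) x)"
      by (auto simp: indicator_def fun_eq_iff)
    then show ?case using closed_span_diff[OF B int compl.IH] by simp
  next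
    case (union X)
    define f where "f k x = (\<Sum>i<k. indicator (X i \<inter> {a..<b}) x :: complex)" for k x
    have dj: "disjoint_family (\<lambda>i. X i \<inter> {a..<b})"
      using union.hyps(1) unfolding disjoint_family_on_def by blast
    have f: "f k x = indicator (\<Union>i<k. X i \<inter> {a..<b}) x" for k x
      unfolding f_def
      by (rule indicator_UN_disjoint[symmetric])
        (auto intro: disjoint_family_on_mono[OF _ dj])
    show ?case
    proof (rule closed_span_dominated[OF B, of f _ "indicator {a..<b}"])
      show "f k \<in> closed_span B" for k
        unfolding f_def[abs_def] by (intro closed_span_sum[OF B] union.IH)
      show "cmod (f k x) \<le> indicator {a..<b} x" for k x
        unfolding f by (auto simp: indicator_def)
      show "(\<lambda>k. f k x) \<longlonglongrightarrow> indicator (\<Union> (range X) \<inter> {a..<b}) x" for x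
      proof (cases "x \<in> \<Union> (range X) \<inter> {a..<b}")
        case True
        then obtain i where "x \<in> X i" "x \<in> {a..<b}" by auto
        then have "\<forall>\<^sub>F k in sequentially. f k x = 1"
          unfolding f eventually_sequentially by (intro exI[of _ "Suc i"]) (auto simp: indicator_def)
        then show ?thesis using True by (auto intro: tendsto_eventually)
      next
        case False
        then have "f k x = 0" for k unfolding f by (auto simp: indicator_def)
        then show ?thesis using False by simp
      qed
    qed (rule integrable_indicator_window)
  qed
qed

lemma closed_span_indicator_lebesgue:
  fixes a b :: real
  assumes B: "B \<subseteq> L2_functions"
    and int: "\<And>a b. indicator {a..<b::real} \<in> closed_span B"
    and A: "A \<in> sets lebesgue"
  shows "indicator (A \<inter> {a..<b}) \<in> closed_span B"
proof -
  obtain S N N' where S: "A = S \<union> N" "N \<subseteq> N'" "N' \<in> null_sets lborel" "S \<in> sets lborel"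
    using A by (rule sets_completionE)
  have "AE x in lebesgue. x \<notin> N'" using S(3) by (intro AE_completion AE_not_in)
  then have ae: "AE x in lebesgue. (indicator (A \<inter> {a..<b}) x :: complex) = indicator (S \<inter> {a..<b}) x"
    by eventually_elim (use S(1,2) in \<open>auto simp: indicator_def\<close>)
  have "A \<inter> {a..<b} \<in> sets lebesgue"
    by (intro sets.Int A sets_completionI_sets) simp
  then have meas: "indicator (A \<inter> {a..<b}) \<in> borel_measurable lebesgue"
    by (rule borel_measurable_indicator)
  have "indicator (S \<inter> {a..<b}) \<in> closed_span B"
    using closed_span_indicator_borel[OF B int] S(4) by simp
  from closed_span_AE[OF B this meas ae] show ?thesis .
qed

text \<open>
  A square integrable function is a limit of simple functions dominated by twice its absolute
  value; cutting these off outside growing intervals makes them combinations of indicators of bounded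
  measurable sets.
\<close>

lemma L2_in_closed_span:
  assumes B: "B \<subseteq> L2_functions"
    and int: "\<And>a b. indicator {a..<b::real} \<in> closed_span B"
    and f: "f \<in> L2_functions"
  shows "f \<in> closed_span B"
proof -
  obtain F where F: "\<And>i. simple_function lebesgue (F i)" "\<And>x. (\<lambda>i. F i x) \<longlonglongrightarrow> f x"
    "\<And>i x. dist (F i x) 0 \<le> 2 * dist (f x) 0"
    using borel_measurable_implies_sequence_metric[OF L2_functionsD(1)[OF f], of 0] by auto
  define g where "g k x = F k x * indicator {- real k..<real k} x" for k x
  show ?thesis
  proof (rule closed_span_dominated[OF B, of g _ "\<lambda>x. 2 * cmod (f x)"])
    show "g k \<in> closed_span B" for k
    proof -
      have fin: "finite (range (F k))" using simple_functionD(1)[OF F(1), of k] by simp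
      have "g k = (\<lambda>x. \<Sum>y\<in>range (F k). y * indicator (F k -` {y} \<inter> {- real k..<real k}) x)"
      proof
        fix x
        have "(\<Sum>y\<in>range (F k). y * indicator (F k -` {y} \<inter> {- real k..<real k}) x)
            = (\<Sum>y\<in>range (F k). if y = F k x then F k x * indicator {- real k..<real k} x else 0)"
          by (intro sum.cong refl) (auto simp: indicator_def)
        then show "g k x = (\<Sum>y\<in>range (F k). y * indicator (F k -` {y} \<inter> {- real k..<real k}) x)"
          using fin by (simp add: g_def)
      qed
      moreover have "F k -` {y} \<in> sets lebesgue" for y
        using simple_functionD(2)[OF F(1), of k "{y}"] by simp
      ultimately show ?thesis
        by (auto intro!: closed_span_sum[OF B] closed_span_cmult
            closed_span_indicator_lebesgue[OF B int])
    qed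
    show "integrable lebesgue (\<lambda>x. (2 * cmod (f x))\<^sup>2)"
      using L2_functionsD(2)[OF f] by (simp add: power_mult_distrib)
    show "cmod (g k x) \<le> 2 * cmod (f x)" for k x
      using F(3)[of k x] by (auto simp: g_def indicator_def)
    show "(\<lambda>k. g k x) \<longlonglongrightarrow> f x" for x
    proof (rule Lim_transform_eventually[OF F(2)])
      obtain k0 :: nat where "\<bar>x\<bar> < real k0" using reals_Archimedean2 by blast
      then show "\<forall>\<^sub>F k in sequentially. F k x = g k x"
        unfolding eventually_sequentially g_def
        by (intro exI[of _ k0]) (auto simp: indicator_def)
    qed
  qed
qed

section \<open>The orthonormal basis\<close>

lemma integral_lebesgue_bdd_supp:
  "bdd_supp f \<Longrightarrow> (LINT x|lebesgue. f x) = (LINT x|lborel. f x)"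
  by (intro integral_completion) (simp add: bdd_supp_measurable)

lemma bdd_supp_complex_L2:
  assumes "bdd_supp f"
  shows "(\<lambda>x. complex_of_real (f x)) \<in> L2_functions"
proof (rule L2_functions_dominated[of _ "\<lambda>x. f x * f x"])
  have "f \<in> borel_measurable lborel" using bdd_supp_measurable[OF assms] by simp
  then have "f \<in> borel_measurable lebesgue" by (rule measurable_completion)
  then show "(\<lambda>x. complex_of_real (f x)) \<in> borel_measurable lebesgue" by measurable
  show "integrable lebesgue (\<lambda>x. f x * f x)"
    using bdd_supp_integrable[OF bdd_supp_mult[OF assms assms]] bdd_supp_measurable[OF assms]
    by (subst integrable_completion) auto
qed (simp add: power2_eq_square)

lemma L2_inner_of_real:
  assumes "bdd_supp f" "bdd_supp g"
  shows "L2_inner (\<lambda>x. complex_of_real (f x)) (\<lambda>x. complex_of_real (g x)) = real_inner_prod f g"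
proof -
  have "L2_inner (\<lambda>x. complex_of_real (f x)) (\<lambda>x. complex_of_real (g x))
      = (LINT x|lebesgue. complex_of_real (f x * g x))"
    unfolding L2_inner_def by simp
  also have "\<dots> = complex_of_real (LINT x|lebesgue. f x * g x)"
    by (rule integral_complex_of_real)
  finally show ?thesis
    unfolding real_inner_prod_def integral_lebesgue_bdd_supp[OF bdd_supp_mult[OF assms]] .
qed

lemma L2_sq_of_real:
  assumes "bdd_supp f"
  shows "L2_sq (\<lambda>x. complex_of_real (f x)) = (LINT x|lborel. (f x)\<^sup>2)"
  using integral_lebesgue_bdd_supp[OF bdd_supp_mult[OF assms assms]]
  unfolding L2_sq_def by (simp add: power2_eq_square)

lemma lin_span_of_real:
  assumes "w \<in> lin_span B"
  shows "(\<lambda>x. complex_of_real (w x)) \<in> lin_span ((\<lambda>f x. complex_of_real (f x)) ` B)"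
  using assms
proof (induction rule: lin_span.induct)
  case (step b f c)
  show ?case
    using lin_span.step[OF imageI[OF step(1), of "\<lambda>f x. complex_of_real (f x)"] step(3), of "of_real c"]
    by simp
qed (simp add: lin_span.zero)

lemma indicator_dyadic_cell:
  "indicator (dyadic_cell k i) x
     = complex_of_real (2 powr (- (real_of_int k / 2))) * complex_of_real (scaling_fun 0 k i x)"
proof -
  have "2 powr (- (real_of_int k / 2)) * (2 powr (real_of_int k / 2) * y) = y" for y
    by (simp add: mult.assoc[symmetric] powr_add[symmetric])
  then have "2 powr (- (real_of_int k / 2)) * scaling_fun 0 k i x = indicator (dyadic_cell k i) x"
    unfolding scaling_fun_def dilate_def cell_fun_def legendre_0 dyadic_cell_def
    by (auto simp: indicator_def floor_eq_iff)
  then show ?thesis by (simp flip: of_real_mult add: indicator_def)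
qed

theorem theorem9:
  fixes n :: nat
  shows "L2_orthonormal_basis ((\<lambda>f t. complex_of_real (f t)) ` wavelet_system n)
    \<and> (\<forall>f\<in>wavelet_system n. compactly_supported f \<and> piecewise_polynomial f)"
proof
  let ?B = "(\<lambda>f t. complex_of_real (f t)) ` wavelet_system n"
  have B: "?B \<subseteq> L2_functions"
    by (auto simp: wavelet_system_def intro!: bdd_supp_complex_L2 bdd_supp_wavelet)
  have "L2_orthonormal ?B"
    unfolding L2_orthonormal_def
  proof (intro conjI ballI B)
    fix f g assume "f \<in> ?B" "g \<in> ?B"
    then obtain j k i j' k' i' where f: "f = (\<lambda>t. complex_of_real (wavelet n j k i t))" "j \<le> n"
      and g: "g = (\<lambda>t. complex_of_real (wavelet n j' k' i' t))" "j' \<le> n"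
      unfolding wavelet_system_def by blast
    have inner: "L2_inner f g = of_real (if (j, k, i) = (j', k', i') then 1 else 0)"
      unfolding f g by (simp only: L2_inner_of_real bdd_supp_wavelet wavelet_orthonormal[OF f(2) g(2)])
    have self: "L2_inner f f = 1"
      unfolding f by (simp add: L2_inner_of_real bdd_supp_wavelet wavelet_orthonormal[OF f(2) f(2)])
    show "L2_inner f g = (if f = g then 1 else 0)"
    proof (cases "f = g")
      case False
      then have "(j, k, i) \<noteq> (j', k', i')" unfolding f g by auto
      then show ?thesis using inner False by auto
    qed (use self in simp)
  qed
  moreover have "\<exists>F c. finite F \<and> F \<subseteq> ?B \<and> L2_norm (\<lambda>x. f x - (\<Sum>b\<in>F. c b * b x)) < \<epsilon>"
    if f: "f \<in> L2_functions" and "\<epsilon> > 0" for f \<epsilon>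
  proof -
    \<comment> \<open>The scaling functions of degree 0 are the normalised indicators of dyadic intervals.\<close>
    have scal: "(\<lambda>x. complex_of_real (scaling_fun 0 k i x)) \<in> closed_span ?B" for k i
      unfolding closed_span_def
    proof (intro CollectI conjI allI impI bdd_supp_complex_L2 bdd_supp_scaling_fun)
      fix \<epsilon> :: real assume "\<epsilon> > 0"
      then obtain w where w: "w \<in> lin_span (wavelet_system n)" "bdd_supp w"
        "(LINT x|lborel. (scaling_fun 0 k i x - w x)\<^sup>2) < \<epsilon>"
        using scaling_fun_approx[of 0 n \<epsilon>] by blast
      have "bdd_supp (\<lambda>x. scaling_fun 0 k i x - w x)"
        using bdd_supp_add[OF bdd_supp_scaling_fun bdd_supp_cmult[OF w(2), of "-1"]] by simp
      from L2_sq_of_real[OF this] w(3)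
      have "L2_sq (\<lambda>x. complex_of_real (scaling_fun 0 k i x) - complex_of_real (w x)) < \<epsilon>" by simp
      then show "\<exists>g\<in>lin_span ?B. L2_sq (\<lambda>x. complex_of_real (scaling_fun 0 k i x) - g x) < \<epsilon>"
        using lin_span_of_real[OF w(1)] by (rule bexI)
    qed
    have "indicator (dyadic_cell k i) \<in> closed_span ?B" for k i
    proof -
      have "(indicator (dyadic_cell k i) :: real \<Rightarrow> complex)
          = (\<lambda>x. complex_of_real (2 powr (- (real_of_int k / 2))) * complex_of_real (scaling_fun 0 k i x))"
        by (rule ext) (rule indicator_dyadic_cell)
      then show ?thesis using closed_span_cmult[OF scal] by simp
    qed
    then have "f \<in> closed_span ?B"
      by (intro L2_in_closed_span[OF B _ f] closed_span_indicator_interval[OF B])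
    moreover have "\<epsilon>\<^sup>2 > 0" using \<open>\<epsilon> > 0\<close> by simp
    ultimately obtain g where g: "g \<in> lin_span ?B" "L2_sq (\<lambda>x. f x - g x) < \<epsilon>\<^sup>2"
      by (rule closed_spanE)
    from lin_span_finite_combination[OF g(1)] obtain F c
      where F: "finite F" "F \<subseteq> ?B" "\<And>x. g x = (\<Sum>b\<in>F. c b * b x)" by blast
    have "L2_norm (\<lambda>x. f x - (\<Sum>b\<in>F. c b * b x)) < \<epsilon>"
      using g(2) \<open>\<epsilon> > 0\<close> unfolding L2_norm_def F(3) L2_sq_def
      by (simp add: real_less_lsqrt)
    then show ?thesis using F(1,2) by blast
  qed
  ultimately show "L2_orthonormal_basis ?B" unfolding L2_orthonormal_basis_def by blast
next
  show "\<forall>f\<in>wavelet_system n. compactly_supported f \<and> piecewise_polynomial f"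
    unfolding wavelet_system_def
    by (auto simp: compactly_supported_wavelet piecewise_polynomial_wavelet)
qed

end
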